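(* Assume that there exist four or more (pairwise distinct) states $x_0,x_1^1,\dots,x_1^n,x_2\in\mathcal{X}$, $n\in\mathbb{N}$, such that $\mathcal{X}^s=\{x_0\}$, $\mathcal{X}^m=\{x_1^1,\dots,x_1^n,x_2\}$, and $H(x_2)>H(x_1^r)$, $H(x_1^r)=H(x_1^q)$, $\Phi(x_1^r,x_1^q)-H(x_1^r)<\Gamma_m$ for every $r,q=1,\dots,n$. Then, as $\beta\to\infty$, $$\mathbb{E}_{x_2}[\tau_{\{x_1^1,\dots,x_1^n,x_0\}}]=\frac{\mu_\beta(x_2)}{\mathrm{cap}_\beta(x_2,\{x_1^1,\dots,x_1^n,x_0\})}[1+o(1)],$$ $$\mathbb{E}_{\{x_1^1,\dots,x_1^n\}}[\tau_{x_0}]=\frac{\mu_\beta(\{x_1^1,\dots,x_1^n\})}{\mathrm{cap}_\beta(\{x_1^1,\dots,x_1^n\},x_0)}[1+o(1)],$$ $$\mathbb{E}_{x_1^r}[\tau_{x_0}]=\frac{n\,\mu_\beta(x_1^r)}{\mathrm{cap}_\beta(x_1^r,x_0)}[1+o(1)]\qquad\text{for every } r=1,\dots,n.$$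
   Context: $\mathcal{X}$ is a finite set and $\Delta:\mathcal{X}\times\mathcal{X}\to\mathbb{R}^+\cup\{\infty\}$ (nonnegative values, $0$ allowed) is an irreducible rate function: for all $x,y\in\mathcal{X}$ there is a finite sequence $\omega_1=x,\dots,\omega_n=y$ with $\Delta(\omega_i,\omega_{i+1})<\infty$ for all $i$. For each $\beta>0$, $(X_n)_{n\in\mathbb{N}}$ is a time-homogeneous Markov chain on $\mathcal{X}$ with transition matrix $\mathcal{P}_\beta$, and $\lim_{\beta\to\infty}-\frac{\log\mathcal{P}_\beta(x,y)}{\beta}=\Delta(x,y)$ for all $x,y$. Detailed balance holds: $\mathcal{P}_\beta(x,y)e^{-\beta G(x)}=\mathcal{P}_\beta(y,x)e^{-\beta G(y)}$, where $G:\mathcal{X}\to\mathbb{R}$ is the Hamiltonian (possibly depending on $\beta$). The Gibbs measure is $\mu_\beta(x)=e^{-\beta G(x)}/\sum_{y\in\mathcal{X}}e^{-\beta G(y)}$. The virtual energy is $H(x):=\lim_{\beta\to\infty}G(x)$. The transition energy is $H(x,y):=H(x)+\Delta(x,y)$. A path is a finite sequence $\omega=(\omega_1,\dots,\omega_n)$ in $\mathcal{X}$; its height is $\Phi_\omega=H(\omega_1)$ if $|\omega|=1$ and $\Phi_\omega=\max_{i<|\omega|}H(\omega_i,\omega_{i+1})$ if $|\omega|>1$. The communication height is $\Phi(x,y):=\min_{\omega}\Phi_\omega$ over all paths from $x$ to $y$, and $\Phi(A,B):=\min_{x\in A,y\in B}\Phi(x,y)$ for sets. Let $\mathcal{I}_x:=\{y\mid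 H(y)<H(x)\}$ and $V_x:=\Phi(x,\mathcal{I}_x)-H(x)$, with $V_x=\infty$ if $\mathcal{I}_x=\emptyset$. $\mathcal{X}^s$ is the set of global minima of $H$, $\Gamma_m:=\max_{x\in\mathcal{X}\setminus\mathcal{X}^s}V_x$ and $\mathcal{X}^m:=\{y\in\mathcal{X}\mid V_y=\Gamma_m\}$. The Dirichlet form is $\mathscr{D}_\beta[f]:=\frac12\sum_{y,z\in\mathcal{X}}\mu_\beta(y)\mathcal{P}_\beta(y,z)[f(y)-f(z)]^2$. For nonempty disjoint $Y,Z\subset\mathcal{X}$, $\mathrm{cap}_\beta(Y,Z):=\min\{\mathscr{D}_\beta[f]: f:\mathcal{X}\to[0,1],\ f|_Y=1,\ f|_Z=0\}$; singletons are written without braces. $\tau_A:=\inf\{t>0\mid X_t\in A\}$ is the first hitting time of $A$ and $\mathbb{E}_x$ is expectation for the chain started at $x$. $\mathbb{E}_{\{x_1^1,\dots,x_1^n\}}[\tau_{x_0}]$ denotes the mean hitting time of $x_0$ starting from any state in $\{x_1^1,\dots,x_1^n\}$, i.e. the formula holds for each choice of starting state in that set.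
   Formalization: The third formula is stated only when β(G(x_1^r)−G(x_1^q))→0 for all r,q (automatic if G does not depend on β); for β-dependent G it is false otherwise, since equal limits H(x_1^r)=H(x_1^q) do not give μ_β(x_1^r)/μ_β(x_1^q)→1. *)

theory Defs
  imports "HOL-Probability.Probability" "HOL-Library.Landau_Symbols"
begin

text \<open>
  The finite state space is the universe of a type \<open>'a\<close> of class \<open>finite\<close>.  Energies that may
  be infinite (rates, heights, stability levels) are of type \<open>ereal\<close>.
\<close>

section \<open>Rates and transition probabilities\<close>

definition path_between :: "'a list \<Rightarrow> 'a \<Rightarrow> 'a \<Rightarrow> bool" where
  "path_between \<omega> x y \<longleftrightarrow> \<omega> \<noteq> [] \<and> hd \<omega> = x \<and> last \<omega> = y"

definition irreducible_rate :: "('a \<Rightarrow> 'a \<Rightarrow> ereal) \<Rightarrow> bool" where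
  "irreducible_rate \<Delta> \<longleftrightarrow>
     (\<forall>x y. \<exists>\<omega>. path_between \<omega> x y \<and> (\<forall>i. Suc i < length \<omega> \<longrightarrow> \<Delta> (\<omega> ! i) (\<omega> ! Suc i) < \<infinity>))"

definition stochastic :: "('a::finite \<Rightarrow> 'a \<Rightarrow> real) \<Rightarrow> bool" where
  "stochastic P \<longleftrightarrow> (\<forall>x y. 0 \<le> P x y) \<and> (\<forall>x. (\<Sum>y\<in>UNIV. P x y) = 1)"

text \<open>\<open>- log p\<close> with the convention \<open>- log 0 = \<infinity>\<close>, whereas HOL has \<open>ln 0 = 0\<close>.\<close>

definition neg_log :: "real \<Rightarrow> ereal" where
  "neg_log p = (if p = 0 then \<infinity> else ereal (- ln p))"

section \<open>Energy landscape\<close>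

definition transition_energy :: "('a \<Rightarrow> real) \<Rightarrow> ('a \<Rightarrow> 'a \<Rightarrow> ereal) \<Rightarrow> 'a \<Rightarrow> 'a \<Rightarrow> ereal" where
  "transition_energy H \<Delta> x y = ereal (H x) + \<Delta> x y"

definition path_height :: "('a \<Rightarrow> real) \<Rightarrow> ('a \<Rightarrow> 'a \<Rightarrow> ereal) \<Rightarrow> 'a list \<Rightarrow> ereal" where
  "path_height H \<Delta> \<omega> =
     (if length \<omega> = 1 then ereal (H (hd \<omega>))
      else Max {transition_energy H \<Delta> (\<omega> ! i) (\<omega> ! Suc i) | i. Suc i < length \<omega>})"

text \<open>
  There are infinitely many paths but only finitely many path heights, so this infimum is a
  minimum.
\<close>

definition comm_height :: "('a \<Rightarrow> real) \<Rightarrow> ('a \<Rightarrow> 'a \<Rightarrow> ereal) \<Rightarrow> 'a \<Rightarrow> 'a \<Rightarrow> ereal" where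
  "comm_height H \<Delta> x y = (INF \<omega> \<in> {\<omega>. path_between \<omega> x y}. path_height H \<Delta> \<omega>)"

definition comm_height_sets ::
    "('a \<Rightarrow> real) \<Rightarrow> ('a \<Rightarrow> 'a \<Rightarrow> ereal) \<Rightarrow> 'a set \<Rightarrow> 'a set \<Rightarrow> ereal" where
  "comm_height_sets H \<Delta> A B = (INF x\<in>A. INF y\<in>B. comm_height H \<Delta> x y)"

definition lower_states :: "('a \<Rightarrow> real) \<Rightarrow> 'a \<Rightarrow> 'a set" where
  "lower_states H x = {y. H y < H x}"

definition stability_level :: "('a \<Rightarrow> real) \<Rightarrow> ('a \<Rightarrow> 'a \<Rightarrow> ereal) \<Rightarrow> 'a \<Rightarrow> ereal" where
  "stability_level H \<Delta> x =
     (if lower_states H x = {} then \<infinity>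
      else comm_height_sets H \<Delta> {x} (lower_states H x) - ereal (H x))"

definition stable_states :: "('a \<Rightarrow> real) \<Rightarrow> 'a set" where
  "stable_states H = {x. \<forall>y. H x \<le> H y}"

definition max_stability_level :: "('a::finite \<Rightarrow> real) \<Rightarrow> ('a \<Rightarrow> 'a \<Rightarrow> ereal) \<Rightarrow> ereal" where
  "max_stability_level H \<Delta> = Max (stability_level H \<Delta> ` (UNIV - stable_states H))"

definition metastable_states :: "('a::finite \<Rightarrow> real) \<Rightarrow> ('a \<Rightarrow> 'a \<Rightarrow> ereal) \<Rightarrow> 'a set" where
  "metastable_states H \<Delta> = {y. stability_level H \<Delta> y = max_stability_level H \<Delta>}"

section \<open>Gibbs measure, Dirichlet form and capacity\<close>

text \<open>Here \<open>g\<close> is the Hamiltonian at the given inverse temperature \<open>\<beta>\<close>.\<close>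

definition gibbs :: "real \<Rightarrow> ('a::finite \<Rightarrow> real) \<Rightarrow> 'a \<Rightarrow> real" where
  "gibbs \<beta> g x = exp (- \<beta> * g x) / (\<Sum>y\<in>UNIV. exp (- \<beta> * g y))"

definition dirichlet_form ::
    "('a::finite \<Rightarrow> real) \<Rightarrow> ('a \<Rightarrow> 'a \<Rightarrow> real) \<Rightarrow> ('a \<Rightarrow> real) \<Rightarrow> real" where
  "dirichlet_form \<mu> P f = 1 / 2 * (\<Sum>y\<in>UNIV. \<Sum>z\<in>UNIV. \<mu> y * P y z * (f y - f z)\<^sup>2)"

text \<open>
  For disjoint \<open>Y\<close> and \<open>Z\<close> the infimum is a minimum: the admissible functions form a nonempty
  compact set, on which the Dirichlet form is continuous.
\<close>

definition capacity ::
    "('a::finite \<Rightarrow> real) \<Rightarrow> ('a \<Rightarrow> 'a \<Rightarrow> real) \<Rightarrow> 'a set \<Rightarrow> 'a set \<Rightarrow> real" where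
  "capacity \<mu> P Y Z =
     (INF f \<in> {f. range f \<subseteq> {0..1} \<and> (\<forall>y\<in>Y. f y = 1) \<and> (\<forall>z\<in>Z. f z = 0)}. dirichlet_form \<mu> P f)"

section \<open>The Markov chain and its hitting times\<close>

definition markov_chain_from ::
    "'w measure \<Rightarrow> (nat \<Rightarrow> 'w \<Rightarrow> 'a) \<Rightarrow> ('a \<Rightarrow> 'a \<Rightarrow> real) \<Rightarrow> 'a \<Rightarrow> bool" where
  "markov_chain_from M X P x \<longleftrightarrow>
     prob_space M \<and>
     (\<forall>n. X n \<in> measurable M (count_space UNIV)) \<and>
     (AE \<omega> in M. X 0 \<omega> = x) \<and>
     (\<forall>n w y. \<P>(\<omega> in M. \<forall>i\<le>n. X i \<omega> = w i) \<noteq> 0 \<longrightarrow>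
        \<P>(\<omega> in M. X (Suc n) \<omega> = y \<bar> \<forall>i\<le>n. X i \<omega> = w i) = P (w n) y)"

text \<open>The infimum of the empty set in \<open>enat\<close> is \<open>\<infinity>\<close>.\<close>

definition hitting_time :: "(nat \<Rightarrow> 'w \<Rightarrow> 'a) \<Rightarrow> 'a set \<Rightarrow> 'w \<Rightarrow> enat" where
  "hitting_time X A \<omega> = Inf (enat ` {t. 0 < t \<and> X t \<omega> \<in> A})"

definition mean_hitting_time :: "'w measure \<Rightarrow> (nat \<Rightarrow> 'w \<Rightarrow> 'a) \<Rightarrow> 'a set \<Rightarrow> ennreal" where
  "mean_hitting_time M X A = (\<integral>\<^sup>+ \<omega>. ennreal_of_enat (hitting_time X A \<omega>) \<partial>M)"

section \<open>Asymptotics\<close>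

text \<open>
  \<open>E = g [1 + o(1)]\<close> as \<open>\<beta> \<rightarrow> \<infinity>\<close>.  In particular \<open>E \<beta>\<close> is finite for all large \<open>\<beta>\<close>; it may be
  infinite for small \<open>\<beta>\<close>, where the chain need not be irreducible.
\<close>

definition asymp_one_plus_o :: "(real \<Rightarrow> ennreal) \<Rightarrow> (real \<Rightarrow> real) \<Rightarrow> bool" where
  "asymp_one_plus_o E g \<longleftrightarrow>
     (\<exists>\<epsilon> \<in> o[at_top](\<lambda>_. 1). \<forall>\<^sub>F \<beta> in at_top. E \<beta> = ennreal (g \<beta> * (1 + \<epsilon> \<beta>)))"

text \<open>
  The Hamiltonian may depend on \<open>\<beta>\<close>.  If \<open>G \<beta> x\<close> and \<open>G \<beta> y\<close> merely have the same limit, the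
  ratio of the Gibbs weights of \<open>x\<close> and \<open>y\<close> need not tend to 1 (take \<open>G \<beta> x = 1\<close> and
  \<open>G \<beta> y = 1 + 1 / \<beta>\<close>); it does tend to 1 exactly under the following condition, which follows
  from equality of the limits if \<open>G\<close> does not depend on \<open>\<beta>\<close>.
\<close>

definition gibbs_degenerate :: "(real \<Rightarrow> 'a \<Rightarrow> real) \<Rightarrow> 'a set \<Rightarrow> bool" where
  "gibbs_degenerate G A \<longleftrightarrow>
     (\<forall>x\<in>A. \<forall>y\<in>A. ((\<lambda>\<beta>. \<beta> * (G \<beta> x - G \<beta> y)) \<longlongrightarrow> 0) at_top)"

lemma gibbs_degenerate_const:
  assumes "\<And>\<beta>. \<beta> > 0 \<Longrightarrow> G \<beta> = G0"
    and "\<And>x. ((\<lambda>\<beta>. G \<beta> x) \<longlongrightarrow> H x) at_top"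
    and "\<And>x y. x \<in> A \<Longrightarrow> y \<in> A \<Longrightarrow> H x = H y"
  shows "gibbs_degenerate G A"
proof -
  have G: "\<forall>\<^sub>F \<beta> in at_top. G \<beta> = G0"
    using eventually_gt_at_top[of 0] by eventually_elim (rule assms(1))
  have "G0 x = H x" for x
  proof -
    have "((\<lambda>\<beta>. G \<beta> x) \<longlongrightarrow> G0 x) at_top"
      by (rule tendsto_eventually) (use G in eventually_elim, simp)
    then show ?thesis
      using assms(2) by (rule tendsto_unique[OF trivial_limit_at_top_linorder])
  qed
  then have "G0 x = G0 y" if "x \<in> A" "y \<in> A" for x y
    using assms(3)[OF that] by simp
  then have "((\<lambda>\<beta>. \<beta> * (G \<beta> x - G \<beta> y)) \<longlongrightarrow> 0) at_top" if "x \<in> A" "y \<in> A" for x y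
    by (intro tendsto_eventually) (use G that in \<open>auto elim!: eventually_mono\<close>)
  then show ?thesis
    by (simp add: gibbs_degenerate_def)
qed

end

theory Submission
  imports Defs
begin

text \<open>
  Let \<open>h\<close> be the equilibrium potential that is 1 at \<open>x\<close>, 0 on \<open>A\<close> and harmonic elsewhere.  By
  Green's identity the mean hitting time of \<open>A\<close> from \<open>x\<close> is exactly
  \<open>(\<Sum>y. \<mu> y * h y) / cap(x, A)\<close>, so it remains to localise the numerator.  The states
  reachable from \<open>x\<close> by transitions of energy below \<open>H x + \<Gamma>\<close> form a set that misses \<open>A\<close>, and its
  cut bounds \<open>cap(x, A)\<close> from above.  A path of lower energy along which a function drops from 1
  to 0 bounds its Dirichlet form from below.  Comparing the two shows that \<open>h\<close> tends to 1 on the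
  states from which \<open>x\<close> is reached below \<open>H x + \<Gamma>\<close>.  Every other state \<open>y\<close> contributes
  negligibly: either \<open>\<mu> y / \<mu> x\<close> tends to 0, or \<open>y\<close> reaches \<open>A\<close> by climbing less than \<open>\<Gamma>\<close>, and
  then reciprocity, \<open>h\<^sub>x y * cap(y, A) = h\<^sub>y x * cap(x, A)\<close>, makes \<open>\<mu> y * h y / \<mu> x\<close> vanish.
  Such descents exist because every state that is not metastable can reach a strictly lower one
  by climbing less than \<open>\<Gamma>\<close>.
\<close>

section \<open>Hitting times of a finite Markov chain\<close>

definition laplacian :: "('a::finite \<Rightarrow> 'a \<Rightarrow> real) \<Rightarrow> ('a \<Rightarrow> real) \<Rightarrow> 'a \<Rightarrow> real" where
  "laplacian P f x = f x - (\<Sum>y\<in>UNIV. P x y * f y)"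

lemma less_hitting_time_iff:
  "enat t < hitting_time X A \<omega> \<longleftrightarrow> (\<forall>i. 0 < i \<and> i \<le> t \<longrightarrow> X i \<omega> \<notin> A)"
proof
  assume less: "enat t < hitting_time X A \<omega>"
  show "\<forall>i. 0 < i \<and> i \<le> t \<longrightarrow> X i \<omega> \<notin> A"
  proof (intro allI impI notI)
    fix i assume i: "0 < i \<and> i \<le> t" and "X i \<omega> \<in> A"
    then have "hitting_time X A \<omega> \<le> enat i"
      unfolding hitting_time_def by (intro Inf_lower) auto
    with less i show False
      by (meson enat_ord_simps(1) leD le_less_trans order_trans)
  qed
next
  assume *: "\<forall>i. 0 < i \<and> i \<le> t \<longrightarrow> X i \<omega> \<notin> A"
  have "enat (Suc t) \<le> hitting_time X A \<omega>"
    unfolding hitting_time_def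
  proof (rule Inf_greatest)
    fix e assume "e \<in> enat ` {t. 0 < t \<and> X t \<omega> \<in> A}"
    with * show "enat (Suc t) \<le> e"
      by (auto simp: not_less_eq_eq[symmetric])
  qed
  then show "enat t < hitting_time X A \<omega>"
    by (meson Suc_ile_eq)
qed

lemma measurable_hitting_time:
  fixes X :: "nat \<Rightarrow> 'w \<Rightarrow> 'a::countable"
  assumes [measurable]: "\<And>n. X n \<in> measurable M (count_space UNIV)"
  shows "hitting_time X A \<in> measurable M (count_space UNIV)"
  unfolding measurable_count_space_eq2_countable
proof safe
  fix e :: enat
  have "hitting_time X A -` {e} \<inter> space M =
      {\<omega> \<in> space M. (\<forall>t. enat t < e \<longleftrightarrow> (\<forall>i. 0 < i \<and> i \<le> t \<longrightarrow> X i \<omega> \<notin> A))}"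
  proof -
    \<comment> \<open>A value of \<open>enat\<close>, infinity included, is determined by the
      naturals strictly below it; hence each fibre is a countable Boolean combination of tail
      events.\<close>
    have le: "f \<le> g" if "\<And>t. enat t < f \<Longrightarrow> enat t < g" for f g :: enat
      using that by (cases g) (auto simp: not_le[symmetric])
    have "f = e \<longleftrightarrow> (\<forall>t. enat t < e \<longleftrightarrow> enat t < f)" for f :: enat
      by (blast intro: order_antisym le)
    then show ?thesis
      unfolding less_hitting_time_iff[symmetric] by auto
  qed
  also have "\<dots> \<in> sets M"
    by measurable
  finally show "hitting_time X A -` {e} \<inter> space M \<in> sets M" .
qed simp_all

section \<open>The chain killed on entering \<open>A\<close>, and its mean hitting time\<close>

context
  fixes M :: "'w measure" and X :: "nat \<Rightarrow> 'w \<Rightarrow> 'a::finite" and P :: "'a \<Rightarrow> 'a \<Rightarrow> real"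
    and x :: 'a and A :: "'a set"
  assumes chain: "markov_chain_from M X P x"
begin

interpretation prob_space M
  using chain by (simp add: markov_chain_from_def)

lemma measurable_chain [measurable]: "X n \<in> measurable M (count_space UNIV)"
  using chain by (simp add: markov_chain_from_def)

text \<open>The product form absorbs null histories, about which the Markov property in
  \<open>markov_chain_from\<close> says nothing: there both sides vanish.\<close>

lemma prob_extend_history:
  "prob {\<omega> \<in> space M. X (Suc n) \<omega> = y \<and> (\<forall>i\<le>n. X i \<omega> = w i)} =
     prob {\<omega> \<in> space M. \<forall>i\<le>n. X i \<omega> = w i} * P (w n) y"
proof (cases "prob {\<omega> \<in> space M. \<forall>i\<le>n. X i \<omega> = w i} = 0")
  case True
  have "prob {\<omega> \<in> space M. X (Suc n) \<omega> = y \<and> (\<forall>i\<le>n. X i \<omega> = w i)} \<le>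
      prob {\<omega> \<in> space M. \<forall>i\<le>n. X i \<omega> = w i}"
    by (rule finite_measure_mono) auto
  then show ?thesis
    using True measure_nonneg[of M] by (simp add: order_antisym)
next
  case False
  then have "\<P>(\<omega> in M. X (Suc n) \<omega> = y \<bar> \<forall>i\<le>n. X i \<omega> = w i) = P (w n) y"
    using chain by (simp add: markov_chain_from_def)
  then show ?thesis
    using False by (simp add: cond_prob_def field_simps)
qed

text \<open>The sub-probability law at time \<open>t\<close> of the chain killed on
  \<open>A\<close>. Time 0 is included, unlike in \<open>hitting_time\<close>; for a start outside
  \<open>A\<close> the two differ on a null event only.\<close>

definition survival_prob :: "nat \<Rightarrow> 'a \<Rightarrow> real" where
  "survival_prob t y = prob {\<omega> \<in> space M. X t \<omega> = y \<and> (\<forall>i\<le>t. X i \<omega> \<notin> A)}"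

text \<open>The Markov property speaks of complete histories, so the event is cut into its finitely
  many histories avoiding \<open>A\<close>. The event \<open>Q\<close> is free so that the same
  splitting applies with and without the next step.\<close>

lemma prob_split_history:
  assumes [measurable]: "{\<omega> \<in> space M. Q \<omega>} \<in> sets M"
  shows "prob {\<omega> \<in> space M. Q \<omega> \<and> X n \<omega> = z \<and> (\<forall>i\<le>n. X i \<omega> \<notin> A)} =
    (\<Sum>w\<in>{w \<in> {..n} \<rightarrow>\<^sub>E - A. w n = z}. prob {\<omega> \<in> space M. Q \<omega> \<and> (\<forall>i\<le>n. X i \<omega> = w i)})"
proof -
  let ?W = "{w \<in> {..n} \<rightarrow>\<^sub>E - A. w n = z}"
  let ?E = "\<lambda>w. {\<omega> \<in> space M. Q \<omega> \<and> (\<forall>i\<le>n. X i \<omega> = w i)}"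
  have eq: "{\<omega> \<in> space M. Q \<omega> \<and> X n \<omega> = z \<and> (\<forall>i\<le>n. X i \<omega> \<notin> A)} = (\<Union>w\<in>?W. ?E w)"
  proof (intro equalityI subsetI)
    fix \<omega> assume "\<omega> \<in> {\<omega> \<in> space M. Q \<omega> \<and> X n \<omega> = z \<and> (\<forall>i\<le>n. X i \<omega> \<notin> A)}"
    then have "restrict (\<lambda>i. X i \<omega>) {..n} \<in> ?W" "\<omega> \<in> ?E (restrict (\<lambda>i. X i \<omega>) {..n})"
      by auto
    then show "\<omega> \<in> (\<Union>w\<in>?W. ?E w)"
      by blast
  qed (auto simp: PiE_def Pi_def)
  have "disjoint_family_on ?E ?W"
    unfolding disjoint_family_on_def
  proof (intro ballI impI)
    fix v w assume "v \<in> ?W" "w \<in> ?W" "v \<noteq> w"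
    then obtain i where "i \<le> n" "v i \<noteq> w i"
      by (metis (no_types, lifting) PiE_ext atMost_iff mem_Collect_eq)
    then show "?E v \<inter> ?E w = {}"
      by auto
  qed
  moreover have "finite ?W"
    by (rule finite_subset[OF _ finite_PiE[of "{..n}" "\<lambda>_. - A"]]) auto
  ultimately show ?thesis
    unfolding eq by (intro finite_measure_finite_Union) (auto intro!: sets.sets_Collect)
qed

text \<open>Chapman-Kolmogorov for the killed chain: every history ending in \<open>z\<close>
  contributes the same factor \<open>P z y\<close>, so conditioning on whole histories reduces to
  conditioning on \<open>z\<close>.\<close>

lemma survival_prob_Suc:
  "survival_prob (Suc t) y = (if y \<in> A then 0 else \<Sum>z\<in>UNIV. survival_prob t z * P z y)"
proof (cases "y \<in> A")
  case True
  then have empty: "{\<omega> \<in> space M. X (Suc t) \<omega> = y \<and> (\<forall>i\<le>Suc t. X i \<omega> \<notin> A)} = {}"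
    by auto
  show ?thesis
    unfolding survival_prob_def empty using True by simp
next
  case False
  have "{\<omega> \<in> space M. X (Suc t) \<omega> = y \<and> (\<forall>i\<le>Suc t. X i \<omega> \<notin> A)} =
      (\<Union>z. {\<omega> \<in> space M. X (Suc t) \<omega> = y \<and> X t \<omega> = z \<and> (\<forall>i\<le>t. X i \<omega> \<notin> A)})"
    using False by (auto simp: le_Suc_eq)
  then have "survival_prob (Suc t) y =
      prob (\<Union>z. {\<omega> \<in> space M. X (Suc t) \<omega> = y \<and> X t \<omega> = z \<and> (\<forall>i\<le>t. X i \<omega> \<notin> A)})"
    by (simp add: survival_prob_def)
  also have "\<dots> =
      (\<Sum>z\<in>UNIV. prob {\<omega> \<in> space M. X (Suc t) \<omega> = y \<and> X t \<omega> = z \<and> (\<forall>i\<le>t. X i \<omega> \<notin> A)})"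
    by (rule finite_measure_finite_Union) (auto simp: disjoint_family_on_def)
  also have "\<dots> = (\<Sum>z\<in>UNIV. survival_prob t z * P z y)"
  proof (rule sum.cong[OF refl])
    fix z
    have "prob {\<omega> \<in> space M. X (Suc t) \<omega> = y \<and> X t \<omega> = z \<and> (\<forall>i\<le>t. X i \<omega> \<notin> A)} =
        (\<Sum>w\<in>{w \<in> {..t} \<rightarrow>\<^sub>E - A. w t = z}. prob {\<omega> \<in> space M. \<forall>i\<le>t. X i \<omega> = w i} * P z y)"
      by (subst prob_split_history) (auto simp: prob_extend_history intro!: sum.cong)
    also have "\<dots> = survival_prob t z * P z y"
      unfolding survival_prob_def using prob_split_history[of "\<lambda>_. True" t z]
      by (simp add: sum_distrib_right)
    finally show "prob {\<omega> \<in> space M. X (Suc t) \<omega> = y \<and> X t \<omega> = z \<and> (\<forall>i\<le>t. X i \<omega> \<notin> A)} =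
        survival_prob t z * P z y" .
  qed
  finally show ?thesis
    using False by simp
qed

lemma AE_start: "AE \<omega> in M. X 0 \<omega> = x"
  using chain by (simp add: markov_chain_from_def)

lemma survival_prob_0:
  assumes "x \<notin> A"
  shows "survival_prob 0 y = (if y = x then 1 else 0)"
proof -
  have "survival_prob 0 y = prob {\<omega> \<in> space M. y = x}"
    unfolding survival_prob_def
    by (rule measure_eq_AE) (use AE_start assms in \<open>auto elim: AE_mp\<close>)
  then show ?thesis
    by (simp add: prob_space)
qed

lemma prob_less_hitting_time:
  assumes "x \<notin> A"
  shows "prob {\<omega> \<in> space M. enat t < hitting_time X A \<omega>} = (\<Sum>y\<in>UNIV. survival_prob t y)"
proof -
  have "prob {\<omega> \<in> space M. enat t < hitting_time X A \<omega>} =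
      prob {\<omega> \<in> space M. \<forall>i\<le>t. X i \<omega> \<notin> A}"
  proof (rule measure_eq_AE)
    show "AE \<omega> in M. (\<omega> \<in> {\<omega> \<in> space M. enat t < hitting_time X A \<omega>}) =
        (\<omega> \<in> {\<omega> \<in> space M. \<forall>i\<le>t. X i \<omega> \<notin> A})"
      using AE_start
    proof eventually_elim
      case (elim \<omega>)
      have "(\<forall>i. 0 < i \<and> i \<le> t \<longrightarrow> X i \<omega> \<notin> A) \<longleftrightarrow> (\<forall>i\<le>t. X i \<omega> \<notin> A)"
        using elim assms by (metis gr0I)
      then show ?case
        by (auto simp: less_hitting_time_iff)
    qed
    show "{\<omega> \<in> space M. enat t < hitting_time X A \<omega>} \<in> sets M"
      unfolding less_hitting_time_iff by measurable
  qed measurable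
  also have "{\<omega> \<in> space M. \<forall>i\<le>t. X i \<omega> \<notin> A} =
      (\<Union>y. {\<omega> \<in> space M. X t \<omega> = y \<and> (\<forall>i\<le>t. X i \<omega> \<notin> A)})"
    by auto
  also have "prob \<dots> = (\<Sum>y\<in>UNIV. survival_prob t y)"
    unfolding survival_prob_def
    by (rule finite_measure_finite_Union) (auto simp: disjoint_family_on_def)
  finally show ?thesis .
qed

text \<open>\<open>U t\<close> is the expected remaining time carried by the surviving mass. Off
  \<open>A\<close> the Poisson equation makes it drop by exactly the surviving mass
  \<open>s t\<close>, so the tail sums telescope to \<open>U 0 - U T\<close>, and \<open>U T\<close>
  tends to 0 because \<open>s\<close> is summable and \<open>u\<close> is bounded. Finiteness of the
  mean comes out as a consequence.\<close>

lemma mean_hitting_time_eq_poisson_solution: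
  assumes "x \<notin> A" and nonneg: "\<And>y. 0 \<le> u y" and boundary: "\<And>y. y \<in> A \<Longrightarrow> u y = 0"
    and poisson: "\<And>y. y \<notin> A \<Longrightarrow> laplacian P u y = 1"
  shows "mean_hitting_time M X A = ennreal (u x)"
proof -
  define s where "s t = (\<Sum>y\<in>UNIV. survival_prob t y)" for t
  define U where "U t = (\<Sum>y\<in>UNIV. survival_prob t y * u y)" for t
  have sp_nonneg: "0 \<le> survival_prob t y" for t y
    by (simp add: survival_prob_def)
  have sp_A: "survival_prob t y = 0" if "y \<in> A" for t y
    using that survival_prob_0[OF \<open>x \<notin> A\<close>] survival_prob_Suc \<open>x \<notin> A\<close> by (cases t) auto
  have step: "s t = U t - U (Suc t)" for t
  proof -
    have "U (Suc t) = (\<Sum>y\<in>UNIV. \<Sum>z\<in>UNIV. survival_prob t z * (P z y * u y))"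
      unfolding U_def
      by (intro sum.cong refl) (auto simp: survival_prob_Suc boundary sum_distrib_right mult.assoc)
    also have "\<dots> = (\<Sum>z\<in>UNIV. survival_prob t z * (\<Sum>y\<in>UNIV. P z y * u y))"
      by (subst sum.swap) (simp add: sum_distrib_left)
    finally have "U t - U (Suc t) = (\<Sum>z\<in>UNIV. survival_prob t z * laplacian P u z)"
      by (simp add: U_def laplacian_def right_diff_distrib sum_subtractf)
    \<comment> \<open>On \<open>A\<close> the surviving mass vanishes, which hides the unspecified
      values of the Laplacian there.\<close>
    also have "\<dots> = s t"
      unfolding s_def by (intro sum.cong refl) (metis mult.right_neutral mult_zero_left poisson sp_A)
    finally show ?thesis by simp
  qed
  have U_nonneg: "0 \<le> U t" and s_nonneg: "0 \<le> s t" for t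
    by (auto simp: U_def s_def sp_nonneg nonneg intro!: sum_nonneg)
  have partial: "(\<Sum>t<T. s t) = U 0 - U T" for T
    by (induction T) (auto simp: step)
  have "summable s"
    by (rule bounded_imp_summable[of _ "U 0"])
      (use U_nonneg in \<open>auto simp: s_nonneg partial lessThan_Suc_atMost[symmetric]
        simp del: sum.lessThan_Suc\<close>)
  then have "(\<lambda>t. s t * (\<Sum>y\<in>UNIV. u y)) \<longlonglongrightarrow> 0"
    by (intro tendsto_mult_left_zero summable_LIMSEQ_zero)
  moreover have "U t \<le> s t * (\<Sum>y\<in>UNIV. u y)" for t
    unfolding U_def s_def sum_distrib_right
    by (intro sum_mono mult_left_mono member_le_sum) (auto simp: nonneg sp_nonneg)
  ultimately have "U \<longlonglongrightarrow> 0"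
    using tendsto_sandwich[of "\<lambda>_. 0" U sequentially "\<lambda>t. s t * (\<Sum>y\<in>UNIV. u y)" 0] U_nonneg
    by (simp add: always_eventually)
  then have "(\<lambda>T. \<Sum>t<T. s t) \<longlonglongrightarrow> U 0"
    unfolding partial using tendsto_diff[OF tendsto_const, of U 0 sequentially "U 0"] by simp
  then have "s sums U 0"
    by (simp add: sums_def)
  moreover have "U 0 = u x"
    unfolding U_def survival_prob_0[OF \<open>x \<notin> A\<close>] by (simp add: mult_if_delta)
  ultimately have "s sums u x" by simp
  have "mean_hitting_time M X A = (\<Sum>t. emeasure M {\<omega> \<in> space M. enat t < hitting_time X A \<omega>})"
    unfolding mean_hitting_time_def
    by (subst nn_integral_enat_function) (auto intro: measurable_hitting_time measurable_chain)
  also have "\<dots> = (\<Sum>t. ennreal (s t))"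
    unfolding emeasure_eq_measure prob_less_hitting_time[OF \<open>x \<notin> A\<close>] s_def ..
  also have "\<dots> = ennreal (u x)"
    using \<open>s sums u x\<close> s_nonneg by (metis suminf_ennreal_eq)
  finally show ?thesis .
qed

end

section \<open>Potential theory of a reversible chain\<close>

text \<open>A choice by \<open>SOME\<close> gives a total function of \<open>P\<close>, also where
  no such potential exists; the existence behind its properties comes from
  \<open>dirichlet_problem\<close>.\<close>

definition equilibrium_potential :: "('a::finite \<Rightarrow> 'a \<Rightarrow> real) \<Rightarrow> 'a \<Rightarrow> 'a set \<Rightarrow> 'a \<Rightarrow> real" where
  "equilibrium_potential P x A =
    (SOME h. h x = 1 \<and> (\<forall>y\<in>A. h y = 0) \<and> (\<forall>y. y \<notin> insert x A \<longrightarrow> laplacian P h y = 0))"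

text \<open>Total resistance of the \<open>R\<close>-edges times total conductance out of
  \<open>S\<close>. It is expanded into single ratios so that limits can be taken term by
  term.\<close>

definition cut_ratio ::
    "('a::finite \<Rightarrow> real) \<Rightarrow> ('a \<Rightarrow> 'a \<Rightarrow> real) \<Rightarrow> 'a set \<Rightarrow> ('a \<Rightarrow> 'a \<Rightarrow> bool) \<Rightarrow> real" where
  "cut_ratio \<mu> P S R =
    (\<Sum>(u, v)\<in>{(u, v). R u v}. \<Sum>c\<in>S. \<Sum>d\<in>-S. \<mu> c * P c d / (\<mu> u * P u v))"

locale reversible_chain =
  fixes \<mu> :: "'a::finite \<Rightarrow> real" and P :: "'a \<Rightarrow> 'a \<Rightarrow> real"
  assumes weight_pos: "0 < \<mu> x"
    and stochastic: "stochastic P"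
    and detailed_balance: "\<mu> x * P x y = \<mu> y * P y x"
    and irreducible: "(\<lambda>a b. 0 < P a b)\<^sup>*\<^sup>* x y"
begin

section \<open>Green's identities and comparison of Dirichlet forms\<close>

lemma P_nonneg: "0 \<le> P x y" and P_sum: "(\<Sum>y\<in>UNIV. P x y) = 1"
  using stochastic by (auto simp: stochastic_def)

lemma conductance_nonneg: "0 \<le> \<mu> x * P x y"
  using P_nonneg[of x y] weight_pos[of x] by simp

text \<open>Unit row sums turn \<open>f y * g y\<close> into a double sum, and reversibility makes
  such sums invariant under exchanging \<open>y\<close> and \<open>z\<close>. The four products on
  the right then pair up, which accounts for the factor 1/2.\<close>

lemma greens_identity:
  "(\<Sum>y\<in>UNIV. \<mu> y * (f y * laplacian P g y)) =
    1 / 2 * (\<Sum>y\<in>UNIV. \<Sum>z\<in>UNIV. \<mu> y * P y z * ((f y - f z) * (g y - g z)))"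
proof -
  let ?S = "\<lambda>F. \<Sum>y\<in>UNIV. \<Sum>z\<in>UNIV. \<mu> y * P y z * F y z"
  have swap: "?S F = ?S (\<lambda>y z. F z y)" for F :: "'a \<Rightarrow> 'a \<Rightarrow> real"
    by (subst sum.swap) (simp add: detailed_balance)
  have "(\<Sum>y\<in>UNIV. \<mu> y * (f y * laplacian P g y)) =
      (\<Sum>y\<in>UNIV. (\<Sum>z\<in>UNIV. P y z) * (\<mu> y * f y * g y) - \<mu> y * f y * (\<Sum>z\<in>UNIV. P y z * g z))"
    unfolding P_sum by (simp add: laplacian_def algebra_simps)
  also have "\<dots> = ?S (\<lambda>y z. f y * g y) - ?S (\<lambda>y z. f y * g z)"
    unfolding sum_subtractf sum_distrib_left sum_distrib_right by (simp add: mult_ac)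
  finally have left: "(\<Sum>y\<in>UNIV. \<mu> y * (f y * laplacian P g y)) =
      ?S (\<lambda>y z. f y * g y) - ?S (\<lambda>y z. f y * g z)" .
  have "?S (\<lambda>y z. (f y - f z) * (g y - g z)) =
      ?S (\<lambda>y z. f y * g y) - ?S (\<lambda>y z. f y * g z) - ?S (\<lambda>y z. f z * g y) + ?S (\<lambda>y z. f z * g z)"
    by (simp add: algebra_simps sum_subtractf sum.distrib)
  also have "\<dots> = 2 * (?S (\<lambda>y z. f y * g y) - ?S (\<lambda>y z. f y * g z))"
    using swap[of "\<lambda>y z. f z * g y"] swap[of "\<lambda>y z. f z * g z"] by simp
  finally show ?thesis
    unfolding left by simp
qed

lemma dirichlet_form_eq: "dirichlet_form \<mu> P f = (\<Sum>y\<in>UNIV. \<mu> y * (f y * laplacian P f y))"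
  unfolding greens_identity dirichlet_form_def by (simp add: power2_eq_square)

lemma greens_symmetric:
  "(\<Sum>y\<in>UNIV. \<mu> y * (f y * laplacian P g y)) = (\<Sum>y\<in>UNIV. \<mu> y * (g y * laplacian P f y))"
  unfolding greens_identity by (simp add: mult.commute)

lemma dirichlet_form_nonneg: "0 \<le> dirichlet_form \<mu> P f"
  unfolding dirichlet_form_def using conductance_nonneg by (simp add: sum_nonneg)

lemma edge_le_dirichlet_form: "\<mu> a * P a b * (f a - f b)\<^sup>2 \<le> 2 * dirichlet_form \<mu> P f"
proof -
  have "\<mu> a * P a b * (f a - f b)\<^sup>2 \<le> (\<Sum>z\<in>UNIV. \<mu> a * P a z * (f a - f z)\<^sup>2)"
    using conductance_nonneg
    by (intro member_le_sum[where f = "\<lambda>z. \<mu> a * P a z * (f a - f z)\<^sup>2"]) auto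
  also have "\<dots> \<le> (\<Sum>y\<in>UNIV. \<Sum>z\<in>UNIV. \<mu> y * P y z * (f y - f z)\<^sup>2)"
    using conductance_nonneg
    by (intro member_le_sum[where f = "\<lambda>y. \<Sum>z\<in>UNIV. \<mu> y * P y z * (f y - f z)\<^sup>2"] sum_nonneg) auto
  finally show ?thesis
    by (simp add: dirichlet_form_def)
qed

lemma resistance_nonneg: "0 \<le> (\<Sum>(u, v)\<in>{(u, v). R u v}. 1 / (\<mu> u * P u v))"
  using conductance_nonneg by (intro sum_nonneg) auto

lemma cut_ratio_eq:
  "cut_ratio \<mu> P S R =
    (\<Sum>(u, v)\<in>{(u, v). R u v}. 1 / (\<mu> u * P u v)) * (\<Sum>c\<in>S. \<Sum>d\<in>-S. \<mu> c * P c d)"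
  unfolding cut_ratio_def sum_distrib_right
  by (intro sum.cong refl) (auto simp: sum_divide_distrib)

text \<open>The total resistance \<open>r\<close> of \<open>R\<close> dominates that of every single
  edge, so each step moves \<open>f\<close> by at most \<open>sqrt (2 * r * D)\<close> with
  \<open>D\<close> the Dirichlet form, and \<open>n\<close> steps add up by the triangle inequality.
  Charging the whole relation keeps the bound free of the particular path, apart from its
  length.\<close>

lemma difference_le_along_path:
  assumes "(R ^^ n) y z" and pos: "\<And>u v. R u v \<Longrightarrow> 0 < P u v"
  shows "(f y - f z)\<^sup>2 \<le>
    2 * (real n)\<^sup>2 * (\<Sum>(u, v)\<in>{(u, v). R u v}. 1 / (\<mu> u * P u v)) * dirichlet_form \<mu> P f"
    (is "_ \<le> 2 * _ * ?r * _")
proof -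
  let ?b = "sqrt (2 * ?r * dirichlet_form \<mu> P f)"
  have b: "0 \<le> 2 * ?r * dirichlet_form \<mu> P f"
    using resistance_nonneg dirichlet_form_nonneg by (intro mult_nonneg_nonneg) simp_all
  have edge: "\<bar>f u - f v\<bar> \<le> ?b" if "R u v" for u v
  proof (rule real_le_rsqrt)
    have c: "0 < \<mu> u * P u v"
      using pos[OF that] weight_pos by simp
    have "1 / (\<mu> u * P u v) \<le> ?r"
      using that member_le_sum[of "(u, v)" "{(u, v). R u v}" "\<lambda>(u, v). 1 / (\<mu> u * P u v)"]
        conductance_nonneg by auto
    have "(f u - f v)\<^sup>2 \<le> 2 * dirichlet_form \<mu> P f / (\<mu> u * P u v)"
      using edge_le_dirichlet_form[of u v f] c by (simp add: field_simps)
    also have "\<dots> = 1 / (\<mu> u * P u v) * (2 * dirichlet_form \<mu> P f)"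
      by simp
    also have "\<dots> \<le> ?r * (2 * dirichlet_form \<mu> P f)"
      using \<open>1 / (\<mu> u * P u v) \<le> ?r\<close> dirichlet_form_nonneg[of f] by (intro mult_right_mono) simp_all
    finally show "\<bar>f u - f v\<bar>\<^sup>2 \<le> 2 * ?r * dirichlet_form \<mu> P f"
      by (simp only: power2_abs mult_ac)
  qed
  have "\<bar>f y - f z\<bar> \<le> real n * ?b"
    using assms(1)
  proof (induction n arbitrary: z)
    case (Suc n)
    then obtain w where "(R ^^ n) y w" "R w z"
      by auto
    then have "\<bar>f y - f w\<bar> \<le> real n * ?b" "\<bar>f w - f z\<bar> \<le> ?b"
      using Suc.IH edge by blast+
    moreover have "real (Suc n) * ?b = real n * ?b + ?b"
      by (simp add: distrib_right)
    ultimately show ?case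
      by linarith
  qed simp
  then have "\<bar>f y - f z\<bar>\<^sup>2 \<le> (real n * ?b)\<^sup>2"
    by (intro power_mono) simp_all
  then show ?thesis
    unfolding power_mult_distrib real_sqrt_pow2[OF b] by (simp only: power2_abs mult_ac)
qed

lemma dirichlet_form_zero_imp_constant:
  assumes "dirichlet_form \<mu> P f = 0"
  shows "f x = f y"
  using irreducible[of x y]
proof induction
  case (step y z)
  then have "(f y - f z)\<^sup>2 \<le> 0"
    using edge_le_dirichlet_form[of y z f] assms weight_pos[of y]
    by (simp add: mult_le_0_iff)
  with step.IH show ?case
    by simp
qed simp

text \<open>Pairing \<open>f\<close> with its Laplacian visits each crossing edge once, from the
  side of \<open>S\<close>, so the factor 1/2 of the double sum disappears.\<close>

lemma dirichlet_form_cut: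
  assumes "\<And>y. f y = (if y \<in> S then 1 else 0)"
  shows "dirichlet_form \<mu> P f = (\<Sum>a\<in>S. \<Sum>b\<in>-S. \<mu> a * P a b)"
proof -
  have "dirichlet_form \<mu> P f = (\<Sum>a\<in>UNIV. if a \<in> S then \<mu> a * laplacian P f a else 0)"
    unfolding dirichlet_form_eq by (intro sum.cong) (auto simp: assms)
  also have "\<dots> = (\<Sum>a\<in>S. \<mu> a * laplacian P f a)"
    by (simp add: sum.inter_restrict[symmetric])
  also have "\<dots> = (\<Sum>a\<in>S. \<Sum>b\<in>-S. \<mu> a * P a b)"
  proof (rule sum.cong[OF refl])
    fix a assume "a \<in> S"
    then have "laplacian P f a = (\<Sum>b\<in>UNIV. P a b) - (\<Sum>b\<in>UNIV. if b \<in> S then P a b else 0)"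
      unfolding P_sum laplacian_def by (simp add: assms if_distrib cong: if_cong)
    also have "\<dots> = (\<Sum>b\<in>-S. P a b)"
      by (simp add: sum.inter_restrict[symmetric] Compl_eq_Diff_UNIV sum_diff)
    finally show "\<mu> a * laplacian P f a = (\<Sum>b\<in>-S. \<mu> a * P a b)"
      by (simp add: sum_distrib_left)
  qed
  finally show ?thesis .
qed

section \<open>Solvability of the Dirichlet problem and minimum principles\<close>

lemma dirichlet_problem:
  assumes "B \<noteq> {}"
  shows "\<exists>f. (\<forall>y\<in>B. f y = \<phi> y) \<and> (\<forall>y. y \<notin> B \<longrightarrow> laplacian P f y = g y)"
proof -
  \<comment> \<open>\<open>T\<close> bundles boundary values and Laplacian into one square linear
    system, so solvability follows from a trivial kernel.\<close>
  define T :: "real ^ 'a \<Rightarrow> real ^ 'a"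
    where "T v = (\<chi> y. if y \<in> B then v $ y else laplacian P (($) v) y)" for v
  have "linear T"
    by (rule linearI)
      (auto simp: T_def vec_eq_iff laplacian_def algebra_simps sum.distrib sum_distrib_left)
  moreover have "v = 0" if "T v = 0" for v
  proof -
    have *: "v $ y = 0" if "y \<in> B" for y
      using \<open>T v = 0\<close> that unfolding T_def vec_eq_iff by (auto dest: spec[of _ y])
    have "laplacian P (($) v) y = 0" if "y \<notin> B" for y
      using \<open>T v = 0\<close> that unfolding T_def vec_eq_iff by (auto dest: spec[of _ y])
    \<comment> \<open>A kernel element vanishes on \<open>B\<close> and is harmonic elsewhere, so
      every term of its energy is zero; it is constant, and its value on the nonempty
      \<open>B\<close> is 0.\<close>
    with * have "\<mu> y * (v $ y * laplacian P (($) v) y) = 0" for y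
      by (cases "y \<in> B") auto
    then have "dirichlet_form \<mu> P (($) v) = 0"
      unfolding dirichlet_form_eq by (intro sum.neutral) blast
    moreover obtain b where "b \<in> B"
      using \<open>B \<noteq> {}\<close> by blast
    ultimately show "v = 0"
      using * by (metis dirichlet_form_zero_imp_constant vec_eq_iff zero_index)
  qed
  ultimately have "surj T"
    by (intro linear_injective_imp_surjective) (simp_all add: linear_injective_0)
  then obtain v where "T v = (\<chi> y. if y \<in> B then \<phi> y else g y)"
    by (metis surjD)
  then have v: "(if y \<in> B then v $ y else laplacian P (($) v) y) = (if y \<in> B then \<phi> y else g y)" for y
    by (simp add: T_def vec_eq_iff)
  show ?thesis
  proof (intro exI[of _ "($) v"] conjI allI ballI impI)
    show "v $ y = \<phi> y" if "y \<in> B" for y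
      using v[of y] that by simp
    show "laplacian P (($) v) y = g y" if "y \<notin> B" for y
      using v[of y] that by simp
  qed
qed

lemma strict_minimum_principle:
  assumes "B \<noteq> {}" "\<And>y. y \<in> B \<Longrightarrow> 0 \<le> f y" "\<And>y. y \<notin> B \<Longrightarrow> 0 < laplacian P f y"
  shows "0 \<le> f x"
proof -
  have "range f \<noteq> {}" "finite (range f)"
    by auto
  then obtain y where y: "f y = Min (range f)"
    by (metis Min_in image_iff)
  then have min: "f y \<le> f z" for z
    by simp
  have "f y = (\<Sum>z\<in>UNIV. P y z * f y)"
    by (simp add: sum_distrib_right[symmetric] P_sum)
  also have "\<dots> \<le> (\<Sum>z\<in>UNIV. P y z * f z)"
    by (intro sum_mono mult_left_mono min P_nonneg)
  finally have "y \<in> B"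
    using assms(3)[of y] by (auto simp: laplacian_def)
  then show ?thesis
    using assms(2) min order_trans by blast
qed

text \<open>Adding a small multiple of the solution \<open>u\<close> of
  \<open>laplacian P u y = 1\<close> makes the inequality strict; letting the multiple tend to 0
  gives the claim.\<close>

lemma minimum_principle:
  assumes "B \<noteq> {}" "\<And>y. y \<in> B \<Longrightarrow> 0 \<le> f y" "\<And>y. y \<notin> B \<Longrightarrow> 0 \<le> laplacian P f y"
  shows "0 \<le> f x"
proof (rule field_le_epsilon)
  obtain u where u: "\<And>y. y \<in> B \<Longrightarrow> u y = 0" "\<And>y. y \<notin> B \<Longrightarrow> laplacian P u y = 1"
    using dirichlet_problem[OF \<open>B \<noteq> {}\<close>, of "\<lambda>_. 0" "\<lambda>_. 1"] by auto
  have u_nonneg: "0 \<le> u y" for y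
    by (rule strict_minimum_principle[OF \<open>B \<noteq> {}\<close>, of u]) (simp_all add: u)
  fix e :: real assume "0 < e"
  \<comment> \<open>The summand 1 keeps \<open>d\<close> positive when \<open>u x = 0\<close> and
    still yields \<open>d * u x \<le> e\<close>.\<close>
  define d where "d = e / (1 + u x)"
  have "0 < d"
    using \<open>0 < e\<close> u_nonneg[of x] by (simp add: d_def)
  have "0 \<le> f x + d * u x"
  proof (rule strict_minimum_principle[OF \<open>B \<noteq> {}\<close>, of "\<lambda>y. f y + d * u y"])
    show "0 \<le> f y + d * u y" if "y \<in> B" for y
      using assms(2)[OF that] u(1)[OF that] by simp
    have "laplacian P (\<lambda>y. f y + d * u y) y = laplacian P f y + d * laplacian P u y" for y
      by (simp add: laplacian_def algebra_simps sum.distrib sum_distrib_left)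
    then show "0 < laplacian P (\<lambda>y. f y + d * u y) y" if "y \<notin> B" for y
      using assms(3)[OF that] u(2)[OF that] \<open>0 < d\<close> by simp
  qed
  also have "d * u x \<le> e"
    using \<open>0 < e\<close> u_nonneg[of x] by (simp add: d_def field_simps)
  finally show "0 \<le> f x + e"
    by simp
qed

section \<open>Equilibrium potential, capacity and the exact mean hitting time\<close>

context
  fixes x :: 'a and A :: "'a set"
  assumes x_notin: "x \<notin> A" and A_nonempty: "A \<noteq> {}"
begin

private abbreviation "h \<equiv> equilibrium_potential P x A"

lemma
  shows potential_start: "h x = 1"
    and potential_target: "y \<in> A \<Longrightarrow> h y = 0"
    and potential_harmonic: "y \<notin> insert x A \<Longrightarrow> laplacian P h y = 0"
proof -
  have "\<exists>h. h x = 1 \<and> (\<forall>y\<in>A. h y = 0) \<and> (\<forall>y. y \<notin> insert x A \<longrightarrow> laplacian P h y = 0)"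
  proof -
    obtain h where h: "\<And>y. y \<in> insert x A \<Longrightarrow> h y = (if y = x then 1 else 0)"
        "\<And>y. y \<notin> insert x A \<Longrightarrow> laplacian P h y = 0"
      using dirichlet_problem[of "insert x A" "\<lambda>y. if y = x then 1 else 0" "\<lambda>_. 0"] by blast
    have "h y = 0" if "y \<in> A" for y
      using h(1)[of y] that x_notin by (metis insertCI)
    with h show ?thesis
      by (intro exI[of _ h]) simp
  qed
  from someI_ex[OF this] show "h x = 1" "y \<in> A \<Longrightarrow> h y = 0"
      "y \<notin> insert x A \<Longrightarrow> laplacian P h y = 0"
    unfolding equilibrium_potential_def by blast+
qed

lemma potential_nonneg: "0 \<le> h y"
proof (rule minimum_principle[of "insert x A" h])
  show "insert x A \<noteq> {}"
    by simp
  show "0 \<le> h y" if "y \<in> insert x A" for y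
    using that potential_start potential_target[of y] by (metis insertE order_refl zero_le_one)
  show "0 \<le> laplacian P h y" if "y \<notin> insert x A" for y
    using potential_harmonic[OF that] by simp
qed

lemma potential_le_1: "h y \<le> 1"
proof -
  have "laplacian P (\<lambda>y. 1 - h y) y = - laplacian P h y" for y
  proof -
    have "(\<Sum>z\<in>UNIV. P y z * (1 - h z)) = (\<Sum>z\<in>UNIV. P y z) - (\<Sum>z\<in>UNIV. P y z * h z)"
      by (simp only: right_diff_distrib mult_1_right sum_subtractf)
    then show ?thesis
      unfolding laplacian_def P_sum by linarith
  qed
  then have "0 \<le> laplacian P (\<lambda>y. 1 - h y) y" if "y \<notin> insert x A" for y
    using potential_harmonic[OF that] by simp
  moreover have "0 \<le> 1 - h y" if "y \<in> insert x A" for y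
    using that potential_start potential_target[of y] by (cases "y = x") simp_all
  ultimately have "0 \<le> 1 - h y"
    using minimum_principle[of "insert x A" "\<lambda>y. 1 - h y"] by blast
  then show ?thesis by simp
qed

text \<open>Off \<open>x\<close> each term vanishes: \<open>f\<close> is zero on \<open>A\<close>
  and \<open>h\<close> is harmonic elsewhere. The remaining factor
  \<open>\<mu> x * laplacian P h x\<close> is identified with the Dirichlet form by taking
  \<open>f = h\<close>.\<close>

lemma sum_harmonic:
  assumes "\<And>y. y \<in> A \<Longrightarrow> f y = 0"
  shows "(\<Sum>y\<in>UNIV. \<mu> y * (f y * laplacian P h y)) = f x * dirichlet_form \<mu> P h"
proof -
  have only_x: "(\<Sum>y\<in>UNIV. \<mu> y * (f y * laplacian P h y)) = \<mu> x * (f x * laplacian P h x)"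
    if "\<And>y. y \<in> A \<Longrightarrow> f y = 0" for f
  proof -
    have "f y * laplacian P h y = 0" if "y \<noteq> x" for y
      using that \<open>\<And>y. y \<in> A \<Longrightarrow> f y = 0\<close>[of y] potential_harmonic[of y] by (cases "y \<in> A") simp_all
    then have "(\<Sum>y\<in>UNIV. \<mu> y * (f y * laplacian P h y)) =
        (\<Sum>y\<in>UNIV. if y = x then \<mu> x * (f x * laplacian P h x) else 0)"
      by (intro sum.cong refl) simp
    then show ?thesis
      unfolding sum.delta[OF finite] by simp
  qed
  show ?thesis
    using only_x[of f, OF assms] only_x[of h, OF potential_target]
    by (simp add: dirichlet_form_eq potential_start)
qed

text \<open>Dirichlet's principle: the difference \<open>f - h\<close> vanishes at \<open>x\<close>
  and on \<open>A\<close>, so it is orthogonal to \<open>h\<close> in the energy product and only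
  adds its own energy.\<close>

lemma dirichlet_form_potential_le:
  assumes "f x = 1" "\<And>y. y \<in> A \<Longrightarrow> f y = 0"
  shows "dirichlet_form \<mu> P h \<le> dirichlet_form \<mu> P f"
proof -
  let ?d = "\<lambda>y. f y - h y"
  have "dirichlet_form \<mu> P f = dirichlet_form \<mu> P h + dirichlet_form \<mu> P ?d +
      2 * (1 / 2 * (\<Sum>y\<in>UNIV. \<Sum>z\<in>UNIV. \<mu> y * P y z * ((?d y - ?d z) * (h y - h z))))"
    unfolding dirichlet_form_def sum_distrib_left sum.distrib[symmetric]
    by (intro sum.cong refl) (simp add: power2_eq_square field_simps)
  also have "\<dots> = dirichlet_form \<mu> P h + dirichlet_form \<mu> P ?d"
    unfolding greens_identity[symmetric]
    by (subst sum_harmonic) (auto simp: assms potential_start potential_target)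
  finally show ?thesis
    using dirichlet_form_nonneg[of ?d] by simp
qed

lemma capacity_eq: "capacity \<mu> P {x} A = dirichlet_form \<mu> P h"
  unfolding capacity_def
proof (rule cInf_eq_minimum)
  show "dirichlet_form \<mu> P h \<in> dirichlet_form \<mu> P `
      {f. range f \<subseteq> {0..1} \<and> (\<forall>y\<in>{x}. f y = 1) \<and> (\<forall>z\<in>A. f z = 0)}"
    using potential_nonneg potential_le_1 potential_start potential_target
    by (intro imageI) auto
qed (auto intro: dirichlet_form_potential_le)

lemma capacity_pos: "0 < capacity \<mu> P {x} A"
proof -
  obtain a where "a \<in> A"
    using A_nonempty by blast
  then have "dirichlet_form \<mu> P h \<noteq> 0"
    using dirichlet_form_zero_imp_constant[of h x a] by (auto simp: potential_start potential_target)
  then show ?thesis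
    using dirichlet_form_nonneg[of h] by (simp add: capacity_eq)
qed

lemma capacity_le_cut:
  assumes "x \<in> S" "S \<inter> A = {}"
  shows "capacity \<mu> P {x} A \<le> (\<Sum>c\<in>S. \<Sum>d\<in>-S. \<mu> c * P c d)"
proof -
  have "capacity \<mu> P {x} A \<le> dirichlet_form \<mu> P (\<lambda>y. if y \<in> S then 1 else 0)"
    unfolding capacity_eq using assms by (intro dirichlet_form_potential_le) auto
  also have "\<dots> = (\<Sum>c\<in>S. \<Sum>d\<in>-S. \<mu> c * P c d)"
    by (rule dirichlet_form_cut) simp
  finally show ?thesis .
qed

lemma potential_near_start:
  assumes "x \<in> S" "S \<inter> A = {}" "(R ^^ n) b x" "\<And>u v. R u v \<Longrightarrow> 0 < P u v"
  shows "(1 - h b)\<^sup>2 \<le> 2 * (real n)\<^sup>2 * cut_ratio \<mu> P S R"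
proof -
  let ?r = "\<Sum>(u, v)\<in>{(u, v). R u v}. 1 / (\<mu> u * P u v)"
  have "(1 - h b)\<^sup>2 = (h b - h x)\<^sup>2"
    by (simp add: potential_start power2_commute)
  also have "\<dots> \<le> 2 * (real n)\<^sup>2 * ?r * capacity \<mu> P {x} A"
    unfolding capacity_eq by (rule difference_le_along_path[OF assms(3,4)])
  also have "\<dots> \<le> 2 * (real n)\<^sup>2 * ?r * (\<Sum>c\<in>S. \<Sum>d\<in>-S. \<mu> c * P c d)"
    using resistance_nonneg by (intro mult_left_mono capacity_le_cut assms(1,2)) simp
  finally show ?thesis
    by (simp add: cut_ratio_eq mult.assoc)
qed

text \<open>Pair \<open>h\<close> with the solution \<open>u\<close> of the Poisson equation and
  move the Laplacian from one to the other: one side gives the sum of \<open>\<mu> y * h y\<close>,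
  the other \<open>u x\<close> times the capacity, and \<open>u x\<close> is the mean hitting
  time.\<close>

theorem mean_hitting_time_eq:
  assumes "markov_chain_from M X P x"
  shows "mean_hitting_time M X A = ennreal ((\<Sum>y\<in>UNIV. \<mu> y * h y) / capacity \<mu> P {x} A)"
proof -
  obtain u where u: "\<And>y. y \<in> A \<Longrightarrow> u y = 0" "\<And>y. y \<notin> A \<Longrightarrow> laplacian P u y = 1"
    using dirichlet_problem[OF A_nonempty, of "\<lambda>_. 0" "\<lambda>_. 1"] by auto
  have "0 \<le> u y" for y
    by (rule minimum_principle[OF A_nonempty, of u]) (simp_all add: u)
  then have "mean_hitting_time M X A = ennreal (u x)"
    using assms x_notin u by (intro mean_hitting_time_eq_poisson_solution)
  moreover have "(\<Sum>y\<in>UNIV. \<mu> y * h y) = u x * capacity \<mu> P {x} A"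
  proof -
    have "(\<Sum>y\<in>UNIV. \<mu> y * h y) = (\<Sum>y\<in>UNIV. \<mu> y * (h y * laplacian P u y))"
      by (intro sum.cong refl) (metis mult.right_neutral mult_zero_left potential_target u(2))
    also have "\<dots> = u x * capacity \<mu> P {x} A"
      by (simp add: greens_symmetric[of h u] sum_harmonic u capacity_eq)
    finally show ?thesis .
  qed
  ultimately show ?thesis
    using capacity_pos by simp
qed

text \<open>The constraint on all of \<open>B\<close> leaves fewer admissible functions. They must
  be shown to exist, as an infimum of reals over the empty set is unspecified.\<close>

lemma capacity_le_capacity_set:
  assumes "x \<in> B" "B \<inter> A = {}"
  shows "capacity \<mu> P {x} A \<le> capacity \<mu> P B A"
  unfolding capacity_def
proof (rule cINF_superset_mono)
  let ?F = "{f :: 'a \<Rightarrow> real. range f \<subseteq> {0..1} \<and> (\<forall>y\<in>B. f y = 1) \<and> (\<forall>z\<in>A. f z = 0)}"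
  have "(\<lambda>y. if y \<in> B then 1 else 0) \<in> ?F"
    using assms by auto
  then show "?F \<noteq> {}"
    by (metis empty_iff)
qed (use assms dirichlet_form_nonneg in \<open>auto intro!: bdd_belowI[of _ 0]\<close>)

text \<open>The function \<open>min 1 (h / m)\<close> is admissible for \<open>B\<close> and contracts differences up to \<open>1 / m\<close>.\<close>

lemma capacity_set_le:
  assumes "0 < m" "\<And>y. y \<in> B \<Longrightarrow> m \<le> h y"
  shows "capacity \<mu> P B A \<le> capacity \<mu> P {x} A / m\<^sup>2"
proof -
  let ?f = "\<lambda>y. min 1 (h y / m)"
  have "capacity \<mu> P B A \<le> dirichlet_form \<mu> P ?f"
    unfolding capacity_def
  proof (rule cINF_lower)
    show "?f \<in> {f. range f \<subseteq> {0..1} \<and> (\<forall>y\<in>B. f y = 1) \<and> (\<forall>z\<in>A. f z = 0)}"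
      using assms potential_nonneg by (auto simp: potential_target)
  qed (auto intro!: bdd_belowI[of _ 0] dirichlet_form_nonneg)
  also have "\<dots> \<le> dirichlet_form \<mu> P h / m\<^sup>2"
  proof -
    have "(?f y - ?f z)\<^sup>2 \<le> (h y - h z)\<^sup>2 / m\<^sup>2" for y z
    proof -
      have "\<bar>?f y - ?f z\<bar> \<le> \<bar>h y / m - h z / m\<bar>"
        by linarith
      then have "(?f y - ?f z)\<^sup>2 \<le> (h y / m - h z / m)\<^sup>2"
        by (simp only: abs_le_square_iff)
      then show ?thesis
        by (simp add: diff_divide_distrib[symmetric] power_divide)
    qed
    then show ?thesis
      unfolding dirichlet_form_def times_divide_eq_right[symmetric] sum_divide_distrib
      by (intro mult_left_mono sum_mono conductance_nonneg) simp_all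
  qed
  finally show ?thesis
    by (simp add: capacity_eq)
qed

text \<open>Inside \<open>B\<close> every weight \<open>\<mu> b\<close> is at most
  \<open>sum \<mu> B\<close>, so the relative loss is at most the sum of the defects
  \<open>1 - h b\<close>, whatever the proportions within \<open>B\<close>. Outside, the divisor
  \<open>sum \<mu> B\<close> is replaced by \<open>\<mu> x\<close>, which is no larger.\<close>

lemma mean_occupation_bounds:
  assumes "x \<in> B"
  shows "1 - (\<Sum>b\<in>B. 1 - h b) \<le> (\<Sum>y\<in>UNIV. \<mu> y * h y) / sum \<mu> B"
    and "(\<Sum>y\<in>UNIV. \<mu> y * h y) / sum \<mu> B \<le> 1 + (\<Sum>y\<in>-B. \<mu> y / \<mu> x * h y)"
proof -
  have le: "\<mu> b \<le> sum \<mu> B" if "b \<in> B" for b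
    using that weight_pos less_imp_le by (intro member_le_sum) auto
  then have pos: "0 < sum \<mu> B"
    using weight_pos[of x] assms less_le_trans by blast
  have split: "(\<Sum>y\<in>UNIV. \<mu> y * h y) = (\<Sum>b\<in>B. \<mu> b * h b) + (\<Sum>y\<in>-B. \<mu> y * h y)"
    by (subst sum.union_disjoint[symmetric]) (auto simp: Compl_partition)
  have "(1 - (\<Sum>b\<in>B. 1 - h b)) * sum \<mu> B = sum \<mu> B - (\<Sum>b\<in>B. sum \<mu> B * (1 - h b))"
    by (simp add: algebra_simps sum_distrib_left)
  also have "\<dots> \<le> sum \<mu> B - (\<Sum>b\<in>B. \<mu> b * (1 - h b))"
    using le potential_le_1 by (intro diff_left_mono sum_mono mult_right_mono) auto
  also have "\<dots> = (\<Sum>b\<in>B. \<mu> b * h b)"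
    by (simp add: right_diff_distrib sum_subtractf)
  also have "\<dots> \<le> (\<Sum>y\<in>UNIV. \<mu> y * h y)"
    unfolding split using weight_pos potential_nonneg
    by (intro add_increasing2 order_refl sum_nonneg mult_nonneg_nonneg) (simp_all add: less_imp_le)
  finally show "1 - (\<Sum>b\<in>B. 1 - h b) \<le> (\<Sum>y\<in>UNIV. \<mu> y * h y) / sum \<mu> B"
    using pos by (simp add: pos_le_divide_eq)
  have "(\<Sum>b\<in>B. \<mu> b * h b) \<le> sum \<mu> B"
    using potential_le_1 weight_pos by (intro sum_mono) (simp add: mult_left_le less_imp_le)
  moreover have "(\<Sum>y\<in>-B. \<mu> y * h y) = \<mu> x * (\<Sum>y\<in>-B. \<mu> y / \<mu> x * h y)"
    unfolding sum_distrib_left using weight_pos[of x] by (intro sum.cong) auto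
  moreover have "\<mu> x * (\<Sum>y\<in>-B. \<mu> y / \<mu> x * h y) \<le> sum \<mu> B * (\<Sum>y\<in>-B. \<mu> y / \<mu> x * h y)"
    using le[OF assms] weight_pos potential_nonneg
    by (intro mult_right_mono sum_nonneg) (simp_all add: less_imp_le)
  ultimately show "(\<Sum>y\<in>UNIV. \<mu> y * h y) / sum \<mu> B \<le> 1 + (\<Sum>y\<in>-B. \<mu> y / \<mu> x * h y)"
    unfolding split using pos by (simp add: pos_divide_le_eq algebra_simps)
qed

end

text \<open>Both sides are values of one symmetric pairing: the Laplacian of either potential,
  tested against a function vanishing on \<open>A\<close>, is concentrated at its starting
  state.\<close>

lemma potential_reciprocity:
  assumes "x \<notin> A" "y \<notin> A" "A \<noteq> {}"
  shows "equilibrium_potential P x A y * capacity \<mu> P {y} A =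
    equilibrium_potential P y A x * capacity \<mu> P {x} A"
proof -
  let ?h = "equilibrium_potential P x A" and ?k = "equilibrium_potential P y A"
  have "?h y * capacity \<mu> P {y} A = (\<Sum>z\<in>UNIV. \<mu> z * (?h z * laplacian P ?k z))"
    using sum_harmonic[OF assms(2,3), of ?h] potential_target[OF assms(1,3)] capacity_eq[OF assms(2,3)]
    by simp
  also have "\<dots> = (\<Sum>z\<in>UNIV. \<mu> z * (?k z * laplacian P ?h z))"
    by (rule greens_symmetric)
  also have "\<dots> = ?k x * capacity \<mu> P {x} A"
    using sum_harmonic[OF assms(1,3), of ?k] potential_target[OF assms(2,3)] capacity_eq[OF assms(1,3)]
    by simp
  finally show ?thesis .
qed

text \<open>
  Reciprocity gives a bound by a ratio of capacities.  The Dirichlet form of the potential itself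
  would only give a bound for its square.
\<close>

lemma potential_near_target:
  assumes "x \<notin> A" "y \<notin> A" "a \<in> A" "x \<in> S" "S \<inter> A = {}"
    and "(R ^^ n) y a" "\<And>u v. R u v \<Longrightarrow> 0 < P u v"
  shows "equilibrium_potential P x A y \<le> 2 * (real n)\<^sup>2 * cut_ratio \<mu> P S R"
proof -
  let ?h = "equilibrium_potential P x A" and ?k = "equilibrium_potential P y A"
  let ?r = "\<Sum>(u, v)\<in>{(u, v). R u v}. 1 / (\<mu> u * P u v)"
  have "A \<noteq> {}"
    using \<open>a \<in> A\<close> by auto
  note x = \<open>x \<notin> A\<close> \<open>A \<noteq> {}\<close> and y = \<open>y \<notin> A\<close> \<open>A \<noteq> {}\<close>
  have "(?k y - ?k a)\<^sup>2 \<le> 2 * (real n)\<^sup>2 * ?r * capacity \<mu> P {y} A"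
    unfolding capacity_eq[OF y] by (rule difference_le_along_path[OF assms(6,7)])
  \<comment> \<open>The potential of \<open>y\<close> falls from 1 to 0 along the path, so this
    factor, a lower bound for the capacity in disguise, may be multiplied in.\<close>
  then have "1 \<le> 2 * (real n)\<^sup>2 * ?r * capacity \<mu> P {y} A"
    by (simp add: potential_start[OF y] potential_target[OF y \<open>a \<in> A\<close>])
  then have "?h y \<le> ?h y * (2 * (real n)\<^sup>2 * ?r * capacity \<mu> P {y} A)"
    using mult_left_mono[OF _ potential_nonneg[OF x, of y]] by fastforce
  also have "\<dots> = 2 * (real n)\<^sup>2 * ?r * (?h y * capacity \<mu> P {y} A)"
    by (simp only: mult_ac)
  also have "\<dots> \<le> 2 * (real n)\<^sup>2 * ?r * (\<Sum>c\<in>S. \<Sum>d\<in>-S. \<mu> c * P c d)"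
  proof (intro mult_left_mono)
    have "?h y * capacity \<mu> P {y} A = ?k x * capacity \<mu> P {x} A"
      using x y by (intro potential_reciprocity)
    also have "\<dots> \<le> 1 * capacity \<mu> P {x} A"
      using potential_le_1[OF y] capacity_pos[OF x] by (intro mult_right_mono) simp_all
    also have "\<dots> \<le> (\<Sum>c\<in>S. \<Sum>d\<in>-S. \<mu> c * P c d)"
      using capacity_le_cut[OF x assms(4,5)] by simp
    finally show "?h y * capacity \<mu> P {y} A \<le> (\<Sum>c\<in>S. \<Sum>d\<in>-S. \<mu> c * P c d)" .
  qed (use resistance_nonneg in simp)
  finally show ?thesis
    by (simp add: cut_ratio_eq mult.assoc)
qed

end

section \<open>Communication heights and reachability\<close>

text \<open>Strictness matters: an edge leaving a set closed under this relation has energy at least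
  \<open>L\<close>, and a strict gap is what the exponential estimates need.\<close>

definition below :: "('a \<Rightarrow> real) \<Rightarrow> ('a \<Rightarrow> 'a \<Rightarrow> ereal) \<Rightarrow> ereal \<Rightarrow> 'a \<Rightarrow> 'a \<Rightarrow> bool" where
  "below H \<Delta> L a b \<longleftrightarrow> transition_energy H \<Delta> a b < L"

section \<open>Communication heights as reachability below a threshold\<close>

lemma rtranclp_path:
  assumes "path_between \<omega> x y" "\<And>i. Suc i < length \<omega> \<Longrightarrow> R (\<omega> ! i) (\<omega> ! Suc i)"
  shows "R\<^sup>*\<^sup>* x y"
proof -
  have "R\<^sup>*\<^sup>* (\<omega> ! 0) (\<omega> ! i)" if "i < length \<omega>" for i
    using that by (induction i) (auto intro: rtranclp.rtrancl_into_rtrancl assms(2))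
  from this[of "length \<omega> - 1"] show ?thesis
    using assms(1) by (auto simp: path_between_def hd_conv_nth last_conv_nth)
qed

text \<open>A one-state path has height \<open>H\<close> of its state, which the relation does not
  bound; hence the transitive closure without reflexivity, here and in
  \<open>comm_height_less\<close>.\<close>

lemma tranclp_path:
  assumes "R\<^sup>+\<^sup>+ x y"
  shows "\<exists>\<omega>. path_between \<omega> x y \<and> 2 \<le> length \<omega> \<and>
    (\<forall>i. Suc i < length \<omega> \<longrightarrow> R (\<omega> ! i) (\<omega> ! Suc i))"
  using assms
proof induction
  case (base y)
  then show ?case
    by (intro exI[of _ "[x, y]"]) (auto simp: path_between_def)
next
  case (step y z)
  then obtain \<omega> where \<omega>: "path_between \<omega> x y" "2 \<le> length \<omega>"
    "\<And>i. Suc i < length \<omega> \<Longrightarrow> R (\<omega> ! i) (\<omega> ! Suc i)"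
    by blast
  have "R ((\<omega> @ [z]) ! i) ((\<omega> @ [z]) ! Suc i)" if "Suc i < length (\<omega> @ [z])" for i
  proof (cases "Suc i = length \<omega>")
    case True
    then have "i = length \<omega> - 1"
      by simp
    then have "\<omega> ! i = y"
      using \<omega>(1,2) by (auto simp: path_between_def last_conv_nth)
    with True step.hyps show ?thesis
      by (auto simp: nth_append)
  next
    case False
    with that \<omega>(3)[of i] show ?thesis
      by (auto simp: nth_append)
  qed
  then show ?case
    using \<omega>(1,2) by (intro exI[of _ "\<omega> @ [z]"]) (auto simp: path_between_def)
qed

lemma finite_energies: "finite {f i |i. Suc i < (n::nat)}"
  by (rule finite_subset[of _ "f ` {..<n}"]) auto

lemma comm_height_less_imp:
  assumes "comm_height H \<Delta> x y < L"
  shows "(below H \<Delta> L)\<^sup>*\<^sup>* x y"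
proof -
  obtain \<omega> where \<omega>: "path_between \<omega> x y" "path_height H \<Delta> \<omega> < L"
    using assms by (auto simp: comm_height_def INF_less_iff)
  show ?thesis
  proof (rule rtranclp_path[OF \<omega>(1)])
    fix i assume i: "Suc i < length \<omega>"
    then have "transition_energy H \<Delta> (\<omega> ! i) (\<omega> ! Suc i) \<le> path_height H \<Delta> \<omega>"
      unfolding path_height_def by (auto intro!: Max_ge finite_energies)
    with \<omega>(2) show "below H \<Delta> L (\<omega> ! i) (\<omega> ! Suc i)"
      by (auto simp: below_def)
  qed
qed

lemma comm_height_less:
  assumes "(below H \<Delta> L)\<^sup>+\<^sup>+ x y"
  shows "comm_height H \<Delta> x y < L"
proof -
  obtain \<omega> where \<omega>: "path_between \<omega> x y" "2 \<le> length \<omega>"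
    "\<And>i. Suc i < length \<omega> \<Longrightarrow> below H \<Delta> L (\<omega> ! i) (\<omega> ! Suc i)"
    using tranclp_path[OF assms] by blast
  have "{transition_energy H \<Delta> (\<omega> ! i) (\<omega> ! Suc i) |i. Suc i < length \<omega>} \<noteq> {}"
    using \<omega>(2) by (auto intro!: exI[of _ 0])
  then have "path_height H \<Delta> \<omega> < L"
    using \<omega>(2,3) unfolding path_height_def below_def
    by (auto simp: Max_less_iff[OF finite_energies])
  with \<omega>(1) show ?thesis
    by (auto simp: comm_height_def INF_less_iff)
qed

lemma stability_level_less_imp:
  assumes "stability_level H \<Delta> y < \<Gamma>"
  obtains z where "H z < H y" "(below H \<Delta> (ereal (H y) + \<Gamma>))\<^sup>*\<^sup>* y z"
proof -
  \<comment> \<open>An infinite stability level cannot lie strictly below \<Gamma>, so a lower state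
    exists.\<close>
  from assms have "comm_height_sets H \<Delta> {y} (lower_states H y) - ereal (H y) < \<Gamma>"
    by (auto simp: stability_level_def split: if_splits)
  then have "comm_height_sets H \<Delta> {y} (lower_states H y) < ereal (H y) + \<Gamma>"
    by (simp add: ereal_minus_less_iff add.commute)
  then obtain z where "H z < H y" "comm_height H \<Delta> y z < ereal (H y) + \<Gamma>"
    by (auto simp: comm_height_sets_def INF_less_iff lower_states_def)
  with that show ?thesis
    by (blast intro: comm_height_less_imp)
qed

lemma not_reachable_below_stability_level:
  assumes "H y < H x"
  shows "\<not> (below H \<Delta> (ereal (H x) + stability_level H \<Delta> x))\<^sup>*\<^sup>* x y"
proof
  assume "(below H \<Delta> (ereal (H x) + stability_level H \<Delta> x))\<^sup>*\<^sup>* x y"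
  moreover have "x \<noteq> y"
    using assms by auto
  ultimately have "comm_height H \<Delta> x y < ereal (H x) + stability_level H \<Delta> x"
    by (intro comm_height_less) (blast dest: rtranclpD)
  moreover have "comm_height_sets H \<Delta> {x} (lower_states H x) \<le> comm_height H \<Delta> x y"
    using assms by (auto simp: comm_height_sets_def lower_states_def intro: INF_lower)
  \<comment> \<open>Subtracting and adding back \<open>H x\<close> is harmless even at an infinite
    height, as \<open>H x\<close> is finite.\<close>
  moreover have "ereal (H x) + stability_level H \<Delta> x = comm_height_sets H \<Delta> {x} (lower_states H x)"
    using assms unfolding stability_level_def
    by (cases "comm_height_sets H \<Delta> {x} (lower_states H x)") (auto simp: lower_states_def)
  ultimately show False
    by simp
qed

text \<open>Descend repeatedly until \<open>A\<close> is met; the number of strictly lower states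
  decreases, and a state with none must lie in \<open>A\<close>, its level being infinite. Every
  later climb starts from lower energy, so the single threshold \<open>L\<close> covers all of
  them.\<close>

lemma descent_to_set:
  fixes H :: "'a::finite \<Rightarrow> real"
  assumes "\<And>z. z = y \<or> H z < H y \<Longrightarrow> z \<notin> A \<Longrightarrow> stability_level H \<Delta> z < \<Gamma>"
    and "ereal (H y) + \<Gamma> \<le> L"
  shows "\<exists>a\<in>A. (below H \<Delta> L)\<^sup>*\<^sup>* y a"
  using assms
proof (induction "card {z. H z < H y}" arbitrary: y rule: less_induct)
  case less
  show ?case
  proof (cases "y \<in> A")
    case False
    then obtain z where z: "H z < H y" "(below H \<Delta> (ereal (H y) + \<Gamma>))\<^sup>*\<^sup>* y z"
      using stability_level_less_imp[OF less.prems(1)[of y]] by blast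
    have "(below H \<Delta> L)\<^sup>*\<^sup>* y z"
      using z(2) by (rule rtranclp_mono[THEN predicate2D, rotated])
        (use less.prems(2) in \<open>auto simp: below_def\<close>)
    moreover have "\<exists>a\<in>A. (below H \<Delta> L)\<^sup>*\<^sup>* z a"
    proof (rule less.hyps)
      have "{w. H w < H z} \<subset> {w. H w < H y}"
        using z(1) by auto
      then show "card {w. H w < H z} < card {w. H w < H y}"
        by (intro psubset_card_mono) auto
      show "stability_level H \<Delta> w < \<Gamma>" if "w = z \<or> H w < H z" "w \<notin> A" for w
        using that z(1) by (intro less.prems(1)) auto
      have "ereal (H z) + \<Gamma> \<le> ereal (H y) + \<Gamma>"
        using z(1) by (intro add_right_mono) simp
      then show "ereal (H z) + \<Gamma> \<le> L"
        using less.prems(2) by (rule order_trans)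
    qed
    ultimately show ?thesis
      by (meson rtranclp_trans)
  qed auto
qed

section \<open>Low-temperature asymptotics\<close>

lemma asymp_one_plus_oI:
  assumes E: "\<forall>\<^sub>F \<beta> in at_top. E \<beta> = ennreal (r \<beta>)"
    and g: "\<forall>\<^sub>F \<beta> in at_top. g \<beta> \<noteq> 0"
    and lim: "((\<lambda>\<beta>. r \<beta> / g \<beta>) \<longlongrightarrow> 1) at_top"
  shows "asymp_one_plus_o E g"
  unfolding asymp_one_plus_o_def
proof (rule bexI)
  show "\<forall>\<^sub>F \<beta> in at_top. E \<beta> = ennreal (g \<beta> * (1 + (r \<beta> / g \<beta> - 1)))"
    using E g by eventually_elim simp
  have "((\<lambda>\<beta>. r \<beta> / g \<beta> - 1) \<longlongrightarrow> 0) at_top"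
    using lim by (rule LIM_zero)
  then show "(\<lambda>\<beta>. r \<beta> / g \<beta> - 1) \<in> o[at_top](\<lambda>_. 1)"
    by (intro smalloI_tendsto) simp_all
qed

lemma exp_neg_linear_tendsto_0:
  fixes f :: "real \<Rightarrow> real"
  assumes "(f \<longlongrightarrow> c) at_top" "0 < c"
  shows "((\<lambda>\<beta>. exp (- \<beta> * f \<beta>)) \<longlongrightarrow> 0) at_top"
proof -
  have "filterlim (\<lambda>\<beta>. f \<beta> * \<beta>) at_top at_top"
    using assms filterlim_ident by (rule filterlim_tendsto_pos_mult_at_top)
  then have "filterlim (\<lambda>\<beta>. - (f \<beta> * \<beta>)) at_bot at_top"
    by (simp add: filterlim_uminus_at_bot)
  from filterlim_compose[OF exp_at_bot this] show ?thesis
    by (simp add: mult.commute)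
qed

lemma gibbs_pos: "0 < gibbs \<beta> g x"
  by (simp add: gibbs_def sum_pos)

lemma gibbs_nonneg: "0 \<le> gibbs \<beta> g x" and gibbs_nonzero: "gibbs \<beta> g x \<noteq> 0"
  using gibbs_pos[of \<beta> g x] by simp_all

lemma gibbs_ratio: "gibbs \<beta> g y / gibbs \<beta> g x = exp (- \<beta> * (g y - g x))"
proof -
  have "(\<Sum>y\<in>UNIV. exp (- \<beta> * g y)) \<noteq> 0"
    by (rule less_imp_neq[symmetric]) (simp add: sum_pos)
  then show ?thesis
    by (simp add: gibbs_def exp_diff[symmetric] algebra_simps)
qed

section \<open>Exponential rates of Gibbs weights and conductances\<close>

locale energy_landscape =
  fixes \<Delta> :: "'a::finite \<Rightarrow> 'a \<Rightarrow> ereal"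
    and P :: "real \<Rightarrow> 'a \<Rightarrow> 'a \<Rightarrow> real"
    and G :: "real \<Rightarrow> 'a \<Rightarrow> real"
    and H :: "'a \<Rightarrow> real"
  assumes irreducible: "irreducible_rate \<Delta>"
    and stochastic: "\<And>\<beta>. 0 < \<beta> \<Longrightarrow> stochastic (P \<beta>)"
    and rate_limit: "\<And>x y. ((\<lambda>\<beta>. neg_log (P \<beta> x y) / ereal \<beta>) \<longlongrightarrow> \<Delta> x y) at_top"
    and detailed_balance:
      "\<And>\<beta> x y. 0 < \<beta> \<Longrightarrow> P \<beta> x y * exp (- \<beta> * G \<beta> x) = P \<beta> y x * exp (- \<beta> * G \<beta> y)"
    and energy_limit: "\<And>x. ((\<lambda>\<beta>. G \<beta> x) \<longlongrightarrow> H x) at_top"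
begin

abbreviation gibbs_measure :: "real \<Rightarrow> 'a \<Rightarrow> real" where
  "gibbs_measure \<beta> \<equiv> gibbs \<beta> (G \<beta>)"

text \<open>The left side is the exponential rate of
  \<open>exp (- \<beta> * G \<beta> a) * P \<beta> a b\<close>, the conductance without
  normalisation. Limits add in \<open>ereal\<close> because that of \<open>G\<close> is
  finite.\<close>

lemma transition_energy_tendsto:
  "((\<lambda>\<beta>. ereal (G \<beta> a) + neg_log (P \<beta> a b) / ereal \<beta>) \<longlongrightarrow> transition_energy H \<Delta> a b) at_top"
  unfolding transition_energy_def
  by (intro tendsto_add_ereal_general rate_limit tendsto_ereal energy_limit) simp

lemma conductance_lower:
  assumes "transition_energy H \<Delta> a b < ereal r"
  shows "\<forall>\<^sub>F \<beta> in at_top. exp (- \<beta> * r) < exp (- \<beta> * G \<beta> a) * P \<beta> a b"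
  using order_tendstoD(2)[OF transition_energy_tendsto assms] eventually_gt_at_top[of 0]
proof eventually_elim
  case (elim \<beta>)
  have "P \<beta> a b \<noteq> 0"
    using elim by (auto simp: neg_log_def)
  moreover have "0 \<le> P \<beta> a b"
    using stochastic[OF \<open>0 < \<beta>\<close>] by (simp add: stochastic_def)
  ultimately have pos: "0 < P \<beta> a b"
    by simp
  have "G \<beta> a - ln (P \<beta> a b) / \<beta> < r"
    using elim pos by (simp add: neg_log_def)
  then have "- \<beta> * r < - \<beta> * G \<beta> a + ln (P \<beta> a b)"
    using \<open>0 < \<beta>\<close> by (simp add: field_simps)
  then have "exp (- \<beta> * r) < exp (- \<beta> * G \<beta> a + ln (P \<beta> a b))"
    by simp
  also have "\<dots> = exp (- \<beta> * G \<beta> a) * P \<beta> a b"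
    unfolding exp_add using pos by simp
  finally show ?case .
qed

lemma conductance_upper:
  assumes "ereal r < transition_energy H \<Delta> a b"
  shows "\<forall>\<^sub>F \<beta> in at_top. exp (- \<beta> * G \<beta> a) * P \<beta> a b < exp (- \<beta> * r)"
  using order_tendstoD(1)[OF transition_energy_tendsto assms] eventually_gt_at_top[of 0]
proof eventually_elim
  case (elim \<beta>)
  show ?case
  proof (cases "P \<beta> a b = 0")
    case False
    moreover have "0 \<le> P \<beta> a b"
      using stochastic[OF \<open>0 < \<beta>\<close>] by (simp add: stochastic_def)
    ultimately have pos: "0 < P \<beta> a b"
      by simp
    have "r < G \<beta> a - ln (P \<beta> a b) / \<beta>"
      using elim pos by (simp add: neg_log_def)
    then have "- \<beta> * G \<beta> a + ln (P \<beta> a b) < - \<beta> * r"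
      using \<open>0 < \<beta>\<close> by (simp add: field_simps)
    then have "exp (- \<beta> * G \<beta> a + ln (P \<beta> a b)) < exp (- \<beta> * r)"
      by simp
    then show ?thesis
      unfolding exp_add using pos by simp
  qed simp
qed

lemma eventually_P_pos:
  assumes "transition_energy H \<Delta> a b < L"
  shows "\<forall>\<^sub>F \<beta> in at_top. 0 < P \<beta> a b"
proof -
  obtain r where "transition_energy H \<Delta> a b < ereal r"
    using assms ereal_dense2 by blast
  from conductance_lower[OF this] show ?thesis
  proof eventually_elim
    case (elim \<beta>)
    then have "0 < exp (- \<beta> * G \<beta> a) * P \<beta> a b"
      using exp_gt_zero less_trans by blast
    then show ?case
      by (simp add: zero_less_mult_iff)
  qed
qed

text \<open>A finite rate guarantees a positive transition probability only for large \<beta>; there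
  are finitely many pairs, so one threshold serves all and irreducibility of the rates passes to the
  chain.\<close>

lemma eventually_reversible_chain: "\<forall>\<^sub>F \<beta> in at_top. reversible_chain (gibbs_measure \<beta>) (P \<beta>)"
proof -
  have "\<forall>\<^sub>F \<beta> in at_top. \<forall>b. \<Delta> a b < \<infinity> \<longrightarrow> 0 < P \<beta> a b" for a
  proof (rule eventually_all_finite)
    fix b
    show "\<forall>\<^sub>F \<beta> in at_top. \<Delta> a b < \<infinity> \<longrightarrow> 0 < P \<beta> a b"
    proof (cases "\<Delta> a b < \<infinity>")
      case True
      then have "transition_energy H \<Delta> a b < \<infinity>"
        by (simp add: transition_energy_def)
      from eventually_P_pos[OF this] show ?thesis
        by simp
    qed simp
  qed
  then have "\<forall>\<^sub>F \<beta> in at_top. \<forall>a b. \<Delta> a b < \<infinity> \<longrightarrow> 0 < P \<beta> a b"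
    by (rule eventually_all_finite)
  with eventually_gt_at_top[of 0] show ?thesis
  proof eventually_elim
    case (elim \<beta>)
    show ?case
    proof
      show "0 < gibbs_measure \<beta> x" for x
        by (rule gibbs_pos)
      show "stochastic (P \<beta>)"
        by (rule stochastic) fact
      show "gibbs_measure \<beta> x * P \<beta> x y = gibbs_measure \<beta> y * P \<beta> y x" for x y
        using detailed_balance[OF \<open>0 < \<beta>\<close>, of x y] by (simp add: gibbs_def field_simps)
      show "(\<lambda>a b. 0 < P \<beta> a b)\<^sup>*\<^sup>* x y" for x y
      proof -
        obtain \<omega> where \<omega>: "path_between \<omega> x y"
          "\<And>i. Suc i < length \<omega> \<Longrightarrow> \<Delta> (\<omega> ! i) (\<omega> ! Suc i) < \<infinity>"
          using irreducible unfolding irreducible_rate_def by blast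
        show ?thesis
          by (rule rtranclp_path[OF \<omega>(1)]) (use \<omega>(2) elim in blast)
      qed
    qed
  qed
qed

lemma gibbs_ratio_tendsto_0:
  assumes "H x < H y"
  shows "((\<lambda>\<beta>. gibbs_measure \<beta> y / gibbs_measure \<beta> x) \<longlongrightarrow> 0) at_top"
  unfolding gibbs_ratio
  by (rule exp_neg_linear_tendsto_0[OF tendsto_diff[OF energy_limit energy_limit]]) (simp add: assms)

text \<open>The exponents combine to \<open>H y - H x + (s - r)\<close>: the real \<open>r\<close>
  lies between the energy of \<open>(u, v)\<close> and \<open>H y + \<Gamma>\<close>, the real
  \<open>s\<close> between \<open>r + H x - H y\<close> and the energy of \<open>(c, d)\<close>. The
  strict first inequality leaves the gap, and real separators remain available when \<Gamma> is
  infinite.\<close>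

lemma conductance_ratio_tendsto_0:
  assumes "transition_energy H \<Delta> u v < ereal (H y) + \<Gamma>"
    and "ereal (H x) + \<Gamma> \<le> transition_energy H \<Delta> c d"
  shows "((\<lambda>\<beta>. gibbs_measure \<beta> y / gibbs_measure \<beta> x *
    (gibbs_measure \<beta> c * P \<beta> c d / (gibbs_measure \<beta> u * P \<beta> u v))) \<longlongrightarrow> 0) at_top"
proof -
  obtain r where r: "transition_energy H \<Delta> u v < ereal r" "ereal r < ereal (H y) + \<Gamma>"
    using ereal_dense2[OF assms(1)] by blast
  then have "ereal (r + H x - H y) < ereal (H x) + \<Gamma>"
    by (cases \<Gamma>) auto
  then have "ereal (r + H x - H y) < transition_energy H \<Delta> c d"
    using assms(2) by (rule less_le_trans)
  then obtain s where s: "r + H x - H y < s" "ereal s < transition_energy H \<Delta> c d"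
    using ereal_dense2 by fastforce
  show ?thesis
  proof (rule tendsto_sandwich[OF _ _ tendsto_const])
    show "((\<lambda>\<beta>. exp (- \<beta> * (G \<beta> y - G \<beta> x + (s - r)))) \<longlongrightarrow> 0) at_top"
      by (rule exp_neg_linear_tendsto_0[OF tendsto_add[OF
              tendsto_diff[OF energy_limit energy_limit] tendsto_const]])
        (use s(1) in simp)
    show "\<forall>\<^sub>F \<beta> in at_top. 0 \<le> gibbs_measure \<beta> y / gibbs_measure \<beta> x *
        (gibbs_measure \<beta> c * P \<beta> c d / (gibbs_measure \<beta> u * P \<beta> u v))"
      using eventually_gt_at_top[of 0]
    proof eventually_elim
      case (elim \<beta>)
      then have "0 \<le> P \<beta> a b" for a b
        using stochastic by (simp add: stochastic_def)
      then show ?case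
        by (intro mult_nonneg_nonneg divide_nonneg_nonneg gibbs_nonneg)
    qed
    show "\<forall>\<^sub>F \<beta> in at_top. gibbs_measure \<beta> y / gibbs_measure \<beta> x *
        (gibbs_measure \<beta> c * P \<beta> c d / (gibbs_measure \<beta> u * P \<beta> u v)) \<le>
        exp (- \<beta> * (G \<beta> y - G \<beta> x + (s - r)))"
      using conductance_lower[OF r(1)] conductance_upper[OF s(2)]
    proof eventually_elim
      case (elim \<beta>)
      let ?Z = "\<Sum>y\<in>UNIV. exp (- \<beta> * G \<beta> y)"
      have "0 < ?Z"
        by (simp add: sum_pos)
      then have "gibbs_measure \<beta> c * P \<beta> c d / (gibbs_measure \<beta> u * P \<beta> u v) =
          (exp (- \<beta> * G \<beta> c) * P \<beta> c d) / (exp (- \<beta> * G \<beta> u) * P \<beta> u v)"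
        by (simp add: gibbs_def)
      also have "\<dots> \<le> exp (- \<beta> * s) / exp (- \<beta> * r)"
        using elim by (intro frac_le) simp_all
      finally have "gibbs_measure \<beta> y / gibbs_measure \<beta> x *
          (gibbs_measure \<beta> c * P \<beta> c d / (gibbs_measure \<beta> u * P \<beta> u v)) \<le>
          exp (- \<beta> * (G \<beta> y - G \<beta> x)) * (exp (- \<beta> * s) / exp (- \<beta> * r))"
        unfolding gibbs_ratio by (rule mult_left_mono) simp
      also have "\<dots> = exp (- \<beta> * (G \<beta> y - G \<beta> x + (s - r)))"
        by (simp add: exp_diff[symmetric] exp_add[symmetric] algebra_simps)
      finally show ?case .
    qed
  qed
qed

lemma cut_ratio_tendsto_0:
  assumes "\<And>u v. R u v \<Longrightarrow> transition_energy H \<Delta> u v < ereal (H y) + \<Gamma>"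
    and "\<And>c d. c \<in> S \<Longrightarrow> d \<notin> S \<Longrightarrow> ereal (H x) + \<Gamma> \<le> transition_energy H \<Delta> c d"
  shows "((\<lambda>\<beta>. gibbs_measure \<beta> y / gibbs_measure \<beta> x *
    cut_ratio (gibbs_measure \<beta>) (P \<beta>) S R) \<longlongrightarrow> 0) at_top"
  unfolding cut_ratio_def sum_distrib_left case_prod_beta
  by (intro tendsto_null_sum conductance_ratio_tendsto_0[where \<Gamma> = \<Gamma>] assms) auto

end

text \<open>
  In \<open>drained\<close> the climb is measured from \<open>H y\<close> and not from \<open>H x\<close>: a state below \<open>x\<close> is
  exponentially heavier than \<open>x\<close>, and its potential has to compensate for that.
\<close>

locale metastable_well = energy_landscape +
  fixes x :: 'a and A B :: "'a set" and \<Gamma> :: ereal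
  assumes x_in: "x \<in> B"
    and disjoint: "B \<inter> A = {}"
    and target_nonempty: "A \<noteq> {}"
    and separated: "\<And>a. a \<in> A \<Longrightarrow> \<not> (below H \<Delta> (ereal (H x) + \<Gamma>))\<^sup>*\<^sup>* x a"
    and well: "\<And>b. b \<in> B \<Longrightarrow> (below H \<Delta> (ereal (H x) + \<Gamma>))\<^sup>*\<^sup>* b x"
    and drained: "\<And>y. y \<notin> A \<Longrightarrow> y \<notin> B \<Longrightarrow>
      H x < H y \<or> (\<exists>a\<in>A. (below H \<Delta> (ereal (H y) + \<Gamma>))\<^sup>*\<^sup>* y a)"
begin

section \<open>Potential, occupation and capacity in a single well\<close>

abbreviation potential :: "real \<Rightarrow> 'a \<Rightarrow> real" where
  "potential \<beta> \<equiv> equilibrium_potential (P \<beta>) x A"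

definition basin :: "'a set" where
  "basin = {z. (below H \<Delta> (ereal (H x) + \<Gamma>))\<^sup>*\<^sup>* x z}"

lemma x_notin: "x \<notin> A"
  using x_in disjoint by auto

lemma x_in_basin: "x \<in> basin"
  by (simp add: basin_def)

lemma basin_disjoint: "basin \<inter> A = {}"
  using separated by (auto simp: basin_def)

lemma basin_cut:
  assumes "c \<in> basin" "d \<notin> basin"
  shows "ereal (H x) + \<Gamma> \<le> transition_energy H \<Delta> c d"
proof (rule ccontr)
  assume "\<not> ?thesis"
  then have "below H \<Delta> (ereal (H x) + \<Gamma>) c d"
    by (simp add: below_def)
  with assms show False
    by (auto simp: basin_def intro: rtranclp.rtrancl_into_rtrancl)
qed

lemma eventually_below_pos: "\<forall>\<^sub>F \<beta> in at_top. \<forall>u v. below H \<Delta> L u v \<longrightarrow> 0 < P \<beta> u v"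
proof (intro eventually_all_finite)
  fix u v
  show "\<forall>\<^sub>F \<beta> in at_top. below H \<Delta> L u v \<longrightarrow> 0 < P \<beta> u v"
    by (cases "below H \<Delta> L u v") (auto simp: below_def dest: eventually_P_pos)
qed

lemma potential_tendsto_1:
  assumes "b \<in> B"
  shows "((\<lambda>\<beta>. potential \<beta> b) \<longlongrightarrow> 1) at_top"
proof -
  let ?R = "below H \<Delta> (ereal (H x) + \<Gamma>)"
  obtain n where n: "(?R ^^ n) b x"
    using well[OF assms] unfolding rtranclp_power by blast
  have "((\<lambda>\<beta>. gibbs_measure \<beta> x / gibbs_measure \<beta> x *
      cut_ratio (gibbs_measure \<beta>) (P \<beta>) basin ?R) \<longlongrightarrow> 0) at_top"
    by (rule cut_ratio_tendsto_0[OF _ basin_cut]) (simp add: below_def)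
  then have "((\<lambda>\<beta>. cut_ratio (gibbs_measure \<beta>) (P \<beta>) basin ?R) \<longlongrightarrow> 0) at_top"
    by (simp add: gibbs_nonzero)
  then have lim: "((\<lambda>\<beta>. 2 * (real n)\<^sup>2 * cut_ratio (gibbs_measure \<beta>) (P \<beta>) basin ?R) \<longlongrightarrow> 0) at_top"
    by (rule tendsto_mult_right_zero)
  have "((\<lambda>\<beta>. (1 - potential \<beta> b)\<^sup>2) \<longlongrightarrow> 0) at_top"
  proof (rule tendsto_sandwich[OF _ _ tendsto_const lim])
    show "\<forall>\<^sub>F \<beta> in at_top. (1 - potential \<beta> b)\<^sup>2 \<le>
        2 * (real n)\<^sup>2 * cut_ratio (gibbs_measure \<beta>) (P \<beta>) basin ?R"
      using eventually_reversible_chain eventually_below_pos[of "ereal (H x) + \<Gamma>"]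
    proof eventually_elim
      case (elim \<beta>)
      then interpret reversible_chain "gibbs_measure \<beta>" "P \<beta>" by blast
      show ?case
        using elim by (intro potential_near_start x_notin target_nonempty x_in_basin basin_disjoint n) blast
    qed
  qed simp
  then have "((\<lambda>\<beta>. sqrt ((1 - potential \<beta> b)\<^sup>2)) \<longlongrightarrow> 0) at_top"
    using tendsto_real_sqrt by fastforce
  then have "((\<lambda>\<beta>. 1 - potential \<beta> b) \<longlongrightarrow> 0) at_top"
    by (simp add: tendsto_rabs_zero_iff)
  from tendsto_diff[OF tendsto_const this, of 1] show ?thesis
    by simp
qed

lemma occupation_tendsto_0:
  assumes "y \<notin> B"
  shows "((\<lambda>\<beta>. gibbs_measure \<beta> y / gibbs_measure \<beta> x * potential \<beta> y) \<longlongrightarrow> 0) at_top"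
proof -
  have nonneg: "\<forall>\<^sub>F \<beta> in at_top. 0 \<le> gibbs_measure \<beta> y / gibbs_measure \<beta> x * potential \<beta> y"
    using eventually_reversible_chain
  proof eventually_elim
    case (elim \<beta>)
    then interpret reversible_chain "gibbs_measure \<beta>" "P \<beta>" .
    show ?case
      by (intro mult_nonneg_nonneg divide_nonneg_nonneg gibbs_nonneg
          potential_nonneg[OF x_notin target_nonempty])
  qed
  consider "y \<in> A" | "H x < H y" |
    a where "y \<notin> A" "a \<in> A" "(below H \<Delta> (ereal (H y) + \<Gamma>))\<^sup>*\<^sup>* y a"
    using drained[OF _ assms] by blast
  then show ?thesis
  proof cases
    case 1
    show ?thesis
    proof (rule tendsto_eventually)
      show "\<forall>\<^sub>F \<beta> in at_top. gibbs_measure \<beta> y / gibbs_measure \<beta> x * potential \<beta> y = 0"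
        using eventually_reversible_chain
      proof eventually_elim
        case (elim \<beta>)
        then interpret reversible_chain "gibbs_measure \<beta>" "P \<beta>" .
        show ?case
          by (simp add: potential_target[OF x_notin target_nonempty 1])
      qed
    qed
  next
    case 2
    show ?thesis
    proof (rule tendsto_sandwich[OF nonneg _ tendsto_const gibbs_ratio_tendsto_0[OF 2]])
      show "\<forall>\<^sub>F \<beta> in at_top. gibbs_measure \<beta> y / gibbs_measure \<beta> x * potential \<beta> y \<le>
          gibbs_measure \<beta> y / gibbs_measure \<beta> x"
        using eventually_reversible_chain
      proof eventually_elim
        case (elim \<beta>)
        then interpret reversible_chain "gibbs_measure \<beta>" "P \<beta>" .
        show ?case
          by (intro mult_right_le_one_le divide_nonneg_nonneg gibbs_nonneg
              potential_nonneg potential_le_1 x_notin target_nonempty)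
      qed
    qed
  next
    case 3
    let ?R = "below H \<Delta> (ereal (H y) + \<Gamma>)"
    obtain n where n: "(?R ^^ n) y a"
      using 3(3) unfolding rtranclp_power by blast
    \<comment> \<open>When \<open>y\<close> lies below \<open>x\<close> the prefactor diverges; the
      climb being measured from \<open>H y\<close>, the cut ratio decays fast enough to absorb
      it.\<close>
    have "((\<lambda>\<beta>. gibbs_measure \<beta> y / gibbs_measure \<beta> x *
        cut_ratio (gibbs_measure \<beta>) (P \<beta>) basin ?R) \<longlongrightarrow> 0) at_top"
      by (rule cut_ratio_tendsto_0[OF _ basin_cut]) (simp add: below_def)
    then have lim: "((\<lambda>\<beta>. 2 * (real n)\<^sup>2 * (gibbs_measure \<beta> y / gibbs_measure \<beta> x *
        cut_ratio (gibbs_measure \<beta>) (P \<beta>) basin ?R)) \<longlongrightarrow> 0) at_top"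
      by (rule tendsto_mult_right_zero)
    show ?thesis
    proof (rule tendsto_sandwich[OF nonneg _ tendsto_const lim])
      show "\<forall>\<^sub>F \<beta> in at_top. gibbs_measure \<beta> y / gibbs_measure \<beta> x * potential \<beta> y \<le>
          2 * (real n)\<^sup>2 * (gibbs_measure \<beta> y / gibbs_measure \<beta> x *
            cut_ratio (gibbs_measure \<beta>) (P \<beta>) basin ?R)"
        using eventually_reversible_chain eventually_below_pos[of "ereal (H y) + \<Gamma>"]
      proof eventually_elim
        case (elim \<beta>)
        then interpret reversible_chain "gibbs_measure \<beta>" "P \<beta>" by blast
        have "potential \<beta> y \<le> 2 * (real n)\<^sup>2 * cut_ratio (gibbs_measure \<beta>) (P \<beta>) basin ?R"
          using elim by (intro potential_near_target[OF x_notin 3(1,2) x_in_basin basin_disjoint n]) blast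
        then have "gibbs_measure \<beta> y / gibbs_measure \<beta> x * potential \<beta> y \<le>
            gibbs_measure \<beta> y / gibbs_measure \<beta> x *
              (2 * (real n)\<^sup>2 * cut_ratio (gibbs_measure \<beta>) (P \<beta>) basin ?R)"
          by (intro mult_left_mono divide_nonneg_nonneg gibbs_nonneg)
        then show ?case
          by (simp only: mult_ac)
      qed
    qed
  qed
qed

text \<open>This one expression bounds from below the relative occupation of \<open>B\<close> and
  every \<open>potential \<beta> b\<close> with \<open>b\<close> in \<open>B\<close>, so it also
  serves as \<open>m\<close> in \<open>capacity_set_le\<close>.\<close>

lemma potential_defect_tendsto: "((\<lambda>\<beta>. 1 - (\<Sum>b\<in>B. 1 - potential \<beta> b)) \<longlongrightarrow> 1) at_top"
proof -
  have "((\<lambda>\<beta>. 1 - (\<Sum>b\<in>B. 1 - potential \<beta> b)) \<longlongrightarrow> 1 - (\<Sum>b\<in>B. 1 - 1)) at_top"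
    by (intro tendsto_diff tendsto_const tendsto_sum potential_tendsto_1)
  then show ?thesis
    by simp
qed

lemma mean_occupation_tendsto_1:
  "((\<lambda>\<beta>. (\<Sum>y\<in>UNIV. gibbs_measure \<beta> y * potential \<beta> y) / sum (gibbs_measure \<beta>) B) \<longlongrightarrow> 1) at_top"
proof (rule tendsto_sandwich[OF _ _ potential_defect_tendsto])
  have "((\<lambda>\<beta>. 1 + (\<Sum>y\<in>-B. gibbs_measure \<beta> y / gibbs_measure \<beta> x * potential \<beta> y)) \<longlongrightarrow> 1 + 0) at_top"
    by (intro tendsto_add tendsto_const tendsto_null_sum occupation_tendsto_0) simp
  then show "((\<lambda>\<beta>. 1 + (\<Sum>y\<in>-B. gibbs_measure \<beta> y / gibbs_measure \<beta> x * potential \<beta> y)) \<longlongrightarrow> 1) at_top"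
    by simp
qed (intro eventually_mono[OF eventually_reversible_chain]
    reversible_chain.mean_occupation_bounds[OF _ x_notin target_nonempty x_in], assumption)+

lemma capacity_ratio_tendsto_1:
  "((\<lambda>\<beta>. capacity (gibbs_measure \<beta>) (P \<beta>) B A / capacity (gibbs_measure \<beta>) (P \<beta>) {x} A) \<longlongrightarrow> 1) at_top"
proof (rule tendsto_sandwich[OF _ _ tendsto_const])
  let ?m = "\<lambda>\<beta>. 1 - (\<Sum>b\<in>B. 1 - potential \<beta> b)"
  show "((\<lambda>\<beta>. 1 / (?m \<beta>)\<^sup>2) \<longlongrightarrow> 1) at_top"
    using tendsto_divide[OF tendsto_const[of 1] tendsto_power[OF potential_defect_tendsto, of 2]] by simp
  show "\<forall>\<^sub>F \<beta> in at_top.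
      1 \<le> capacity (gibbs_measure \<beta>) (P \<beta>) B A / capacity (gibbs_measure \<beta>) (P \<beta>) {x} A"
    using eventually_reversible_chain
  proof eventually_elim
    case (elim \<beta>)
    then interpret reversible_chain "gibbs_measure \<beta>" "P \<beta>" .
    show ?case
      using capacity_le_capacity_set[OF x_notin target_nonempty x_in disjoint]
        capacity_pos[OF x_notin target_nonempty] by simp
  qed
  show "\<forall>\<^sub>F \<beta> in at_top.
      capacity (gibbs_measure \<beta>) (P \<beta>) B A / capacity (gibbs_measure \<beta>) (P \<beta>) {x} A \<le> 1 / (?m \<beta>)\<^sup>2"
    using eventually_reversible_chain order_tendstoD(1)[OF potential_defect_tendsto zero_less_one]
  proof eventually_elim
    case (elim \<beta>)
    then interpret reversible_chain "gibbs_measure \<beta>" "P \<beta>" by blast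
    have "1 - potential \<beta> b \<le> (\<Sum>b\<in>B. 1 - potential \<beta> b)" if "b \<in> B" for b
      using that potential_le_1[OF x_notin target_nonempty]
      by (intro member_le_sum) auto
    then have "?m \<beta> \<le> potential \<beta> b" if "b \<in> B" for b
      using that by fastforce
    then have "capacity (gibbs_measure \<beta>) (P \<beta>) B A \<le>
        capacity (gibbs_measure \<beta>) (P \<beta>) {x} A / (?m \<beta>)\<^sup>2"
      using elim by (intro capacity_set_le x_notin target_nonempty) simp_all
    then show ?case
      using capacity_pos[OF x_notin target_nonempty] by (simp add: pos_divide_le_eq)
  qed
qed

lemma eventually_capacity_pos:
  "\<forall>\<^sub>F \<beta> in at_top. 0 < capacity (gibbs_measure \<beta>) (P \<beta>) {x} A \<and>
    0 < capacity (gibbs_measure \<beta>) (P \<beta>) B A"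
  using eventually_reversible_chain
proof eventually_elim
  case (elim \<beta>)
  then interpret reversible_chain "gibbs_measure \<beta>" "P \<beta>" .
  show ?case
    using capacity_pos[OF x_notin target_nonempty]
      capacity_le_capacity_set[OF x_notin target_nonempty x_in disjoint] by linarith
qed

section \<open>Asymptotics of the mean hitting time from a well\<close>

context
  fixes M :: "real \<Rightarrow> 'w measure" and X :: "real \<Rightarrow> nat \<Rightarrow> 'w \<Rightarrow> 'a"
  assumes chain: "\<And>\<beta>. 0 < \<beta> \<Longrightarrow> markov_chain_from (M \<beta>) (X \<beta>) (P \<beta>) x"
begin

lemma eventually_mean_hitting_time:
  "\<forall>\<^sub>F \<beta> in at_top. mean_hitting_time (M \<beta>) (X \<beta>) A =
    ennreal ((\<Sum>y\<in>UNIV. gibbs_measure \<beta> y * potential \<beta> y) / capacity (gibbs_measure \<beta>) (P \<beta>) {x} A)"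
  using eventually_reversible_chain eventually_gt_at_top[of 0]
proof eventually_elim
  case (elim \<beta>)
  then interpret reversible_chain "gibbs_measure \<beta>" "P \<beta>" by blast
  show ?case
    using chain elim by (intro mean_hitting_time_eq x_notin target_nonempty) simp
qed

theorem mean_hitting_time_asymptotics:
  "asymp_one_plus_o (\<lambda>\<beta>. mean_hitting_time (M \<beta>) (X \<beta>) A)
    (\<lambda>\<beta>. sum (gibbs_measure \<beta>) B / capacity (gibbs_measure \<beta>) (P \<beta>) B A)"
proof (rule asymp_one_plus_oI[OF eventually_mean_hitting_time])
  have B_pos: "0 < sum (gibbs_measure \<beta>) B" for \<beta>
    using x_in gibbs_pos by (intro sum_pos) auto
  show "\<forall>\<^sub>F \<beta> in at_top. sum (gibbs_measure \<beta>) B / capacity (gibbs_measure \<beta>) (P \<beta>) B A \<noteq> 0"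
    using eventually_capacity_pos
    by eventually_elim (simp add: B_pos less_imp_neq[symmetric])
  show "((\<lambda>\<beta>. (\<Sum>y\<in>UNIV. gibbs_measure \<beta> y * potential \<beta> y) / capacity (gibbs_measure \<beta>) (P \<beta>) {x} A /
      (sum (gibbs_measure \<beta>) B / capacity (gibbs_measure \<beta>) (P \<beta>) B A)) \<longlongrightarrow> 1) at_top"
    using tendsto_mult[OF mean_occupation_tendsto_1 capacity_ratio_tendsto_1] by (simp add: mult_ac)
qed

text \<open>The exact formula already contains the capacity of \<open>x\<close> alone, so only
  \<open>sum (gibbs_measure \<beta>) B\<close> has to be compared with \<open>card B\<close> equal
  weights.\<close>

theorem mean_hitting_time_asymptotics_degenerate:
  assumes "gibbs_degenerate G B"
  shows "asymp_one_plus_o (\<lambda>\<beta>. mean_hitting_time (M \<beta>) (X \<beta>) A)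
    (\<lambda>\<beta>. real (card B) * gibbs_measure \<beta> x / capacity (gibbs_measure \<beta>) (P \<beta>) {x} A)"
proof (rule asymp_one_plus_oI[OF eventually_mean_hitting_time])
  have "B \<noteq> {}"
    using x_in by auto
  have B_pos: "0 < sum (gibbs_measure \<beta>) B" for \<beta>
    using x_in gibbs_pos by (intro sum_pos) auto
  show "\<forall>\<^sub>F \<beta> in at_top.
      real (card B) * gibbs_measure \<beta> x / capacity (gibbs_measure \<beta>) (P \<beta>) {x} A \<noteq> 0"
    using eventually_capacity_pos by eventually_elim (auto simp: gibbs_nonzero \<open>B \<noteq> {}\<close>)
  have "((\<lambda>\<beta>. (\<Sum>b\<in>B. exp (- (\<beta> * (G \<beta> b - G \<beta> x)))) / card B) \<longlongrightarrow> (\<Sum>b\<in>B. exp (- 0)) / card B) at_top"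
    using assms x_in \<open>B \<noteq> {}\<close> unfolding gibbs_degenerate_def
    by (intro tendsto_divide tendsto_const tendsto_sum tendsto_exp tendsto_minus) auto
  then have "((\<lambda>\<beta>. (\<Sum>b\<in>B. gibbs_measure \<beta> b / gibbs_measure \<beta> x) / card B) \<longlongrightarrow> 1) at_top"
    by (simp add: gibbs_ratio \<open>B \<noteq> {}\<close>)
  then have "((\<lambda>\<beta>. sum (gibbs_measure \<beta>) B / (real (card B) * gibbs_measure \<beta> x)) \<longlongrightarrow> 1) at_top"
    by (simp add: sum_divide_distrib[symmetric] mult.commute)
  from tendsto_mult[OF mean_occupation_tendsto_1 this]
  have "((\<lambda>\<beta>. (\<Sum>y\<in>UNIV. gibbs_measure \<beta> y * potential \<beta> y) / (real (card B) * gibbs_measure \<beta> x)) \<longlongrightarrow> 1) at_top"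
    using B_pos by (simp add: less_imp_neq[symmetric])
  then show "((\<lambda>\<beta>. (\<Sum>y\<in>UNIV. gibbs_measure \<beta> y * potential \<beta> y) / capacity (gibbs_measure \<beta>) (P \<beta>) {x} A /
      (real (card B) * gibbs_measure \<beta> x / capacity (gibbs_measure \<beta>) (P \<beta>) {x} A)) \<longlongrightarrow> 1) at_top"
  proof (rule Lim_transform_eventually)
    show "\<forall>\<^sub>F \<beta> in at_top. (\<Sum>y\<in>UNIV. gibbs_measure \<beta> y * potential \<beta> y) / (real (card B) * gibbs_measure \<beta> x) =
      (\<Sum>y\<in>UNIV. gibbs_measure \<beta> y * potential \<beta> y) / capacity (gibbs_measure \<beta>) (P \<beta>) {x} A /
      (real (card B) * gibbs_measure \<beta> x / capacity (gibbs_measure \<beta>) (P \<beta>) {x} A)"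
      using eventually_capacity_pos by eventually_elim simp
  qed
qed

end

end

section \<open>The two metastable wells\<close>

text \<open>Two kinds of well are used: \<open>x2\<close> alone, draining into \<open>x0\<close> and
  the states \<open>x1 r\<close>, and the states \<open>x1 r\<close> together, draining into
  \<open>x0\<close>. The energy gap keeps \<open>x2\<close> out of every descent in the second
  case.\<close>

theorem theorem2p9:
  fixes \<Delta> :: "'a::finite \<Rightarrow> 'a \<Rightarrow> ereal"
    and P :: "real \<Rightarrow> 'a \<Rightarrow> 'a \<Rightarrow> real"
    and G :: "real \<Rightarrow> 'a \<Rightarrow> real"
    and H :: "'a \<Rightarrow> real"
    and M :: "real \<Rightarrow> 'a \<Rightarrow> 'w measure"
    and X :: "real \<Rightarrow> nat \<Rightarrow> 'w \<Rightarrow> 'a"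
    and n :: nat
    and x0 x2 :: 'a
    and x1 :: "nat \<Rightarrow> 'a"
  assumes "\<And>x y. 0 \<le> \<Delta> x y"
    and "irreducible_rate \<Delta>"
    and "\<And>\<beta>. \<beta> > 0 \<Longrightarrow> stochastic (P \<beta>)"
    and "\<And>x y. ((\<lambda>\<beta>. neg_log (P \<beta> x y) / ereal \<beta>) \<longlongrightarrow> \<Delta> x y) at_top"
    and "\<And>\<beta> x y. \<beta> > 0 \<Longrightarrow> P \<beta> x y * exp (- \<beta> * G \<beta> x) = P \<beta> y x * exp (- \<beta> * G \<beta> y)"
    and "\<And>x. ((\<lambda>\<beta>. G \<beta> x) \<longlongrightarrow> H x) at_top"
    and "\<And>\<beta> x. \<beta> > 0 \<Longrightarrow> markov_chain_from (M \<beta> x) (X \<beta>) (P \<beta>) x"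
    and "n \<ge> 2"
    and "inj_on x1 {1..n}"
    and "x0 \<notin> x1 ` {1..n}" and "x2 \<notin> x1 ` {1..n}" and "x0 \<noteq> x2"
    and "stable_states H = {x0}"
    and "metastable_states H \<Delta> = insert x2 (x1 ` {1..n})"
    and "\<And>r. r \<in> {1..n} \<Longrightarrow> H x2 > H (x1 r)"
    and "\<And>r q. r \<in> {1..n} \<Longrightarrow> q \<in> {1..n} \<Longrightarrow> H (x1 r) = H (x1 q)"
    and "\<And>r q. r \<in> {1..n} \<Longrightarrow> q \<in> {1..n} \<Longrightarrow>
           comm_height H \<Delta> (x1 r) (x1 q) - ereal (H (x1 r)) < max_stability_level H \<Delta>"
  shows
    "asymp_one_plus_o
       (\<lambda>\<beta>. mean_hitting_time (M \<beta> x2) (X \<beta>) (insert x0 (x1 ` {1..n})))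
       (\<lambda>\<beta>. gibbs \<beta> (G \<beta>) x2 /
             capacity (gibbs \<beta> (G \<beta>)) (P \<beta>) {x2} (insert x0 (x1 ` {1..n})))
     \<and> (\<forall>r\<in>{1..n}. asymp_one_plus_o
          (\<lambda>\<beta>. mean_hitting_time (M \<beta> (x1 r)) (X \<beta>) {x0})
          (\<lambda>\<beta>. (\<Sum>y\<in>x1 ` {1..n}. gibbs \<beta> (G \<beta>) y) /
                capacity (gibbs \<beta> (G \<beta>)) (P \<beta>) (x1 ` {1..n}) {x0}))
     \<and> (gibbs_degenerate G (x1 ` {1..n}) \<longrightarrow>
        (\<forall>r\<in>{1..n}. asymp_one_plus_o
          (\<lambda>\<beta>. mean_hitting_time (M \<beta> (x1 r)) (X \<beta>) {x0})
          (\<lambda>\<beta>. real n * gibbs \<beta> (G \<beta>) (x1 r) /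
                capacity (gibbs \<beta> (G \<beta>)) (P \<beta>) {x1 r} {x0})))"
proof -
  let ?B = "x1 ` {1..n}" and ?\<Gamma> = "max_stability_level H \<Delta>"
  interpret energy_landscape \<Delta> P G H
    by unfold_locales (fact assms(2,3,4,5,6))+
  have metastable: "stability_level H \<Delta> z = ?\<Gamma>" if "z \<in> insert x2 ?B" for z
    using that assms(14) by (auto simp: metastable_states_def)
  \<comment> \<open>\<open>x0\<close> is excluded because its stability level is infinite, while
    \<open>?\<Gamma>\<close> is a maximum over the other states.\<close>
  have less: "stability_level H \<Delta> z < ?\<Gamma>" if "z \<noteq> x0" "z \<notin> insert x2 ?B" for z
  proof -
    have "stability_level H \<Delta> z \<le> ?\<Gamma>"
      using that(1) assms(13) unfolding max_stability_level_def by (intro Max_ge) auto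
    moreover have "stability_level H \<Delta> z \<noteq> ?\<Gamma>"
      using that(2) assms(14) by (auto simp: metastable_states_def)
    ultimately show ?thesis
      by simp
  qed
  have minimum: "H x0 < H z" if "z \<noteq> x0" for z
  proof -
    have "z \<notin> stable_states H" "x0 \<in> stable_states H"
      using that assms(13) by auto
    then obtain y where "H y < H z" "H x0 \<le> H y"
      by (auto simp: stable_states_def not_le)
    then show ?thesis
      by simp
  qed
  have separated: "\<not> (below H \<Delta> (ereal (H z) + ?\<Gamma>))\<^sup>*\<^sup>* z a"
    if "z \<in> insert x2 ?B" "H a < H z" for z a
    using not_reachable_below_stability_level[of H a z \<Delta>, OF that(2)] by (simp add: metastable[OF that(1)])
  interpret W2: metastable_well \<Delta> P G H x2 "insert x0 ?B" "{x2}" ?\<Gamma>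
  proof
    show "{x2} \<inter> insert x0 ?B = {}"
      using assms(11,12) by auto
    show "\<not> (below H \<Delta> (ereal (H x2) + ?\<Gamma>))\<^sup>*\<^sup>* x2 a" if "a \<in> insert x0 ?B" for a
      using that minimum[of x2] assms(12,15) by (intro separated) auto
    show "H x2 < H y \<or> (\<exists>a\<in>insert x0 ?B. (below H \<Delta> (ereal (H y) + ?\<Gamma>))\<^sup>*\<^sup>* y a)"
      if "y \<notin> insert x0 ?B" "y \<notin> {x2}" for y
    proof (unfold disj_imp, intro impI, rule descent_to_set)
      \<comment> \<open>Such a \<open>z\<close> is \<open>y\<close> itself, which is not
        \<open>x2\<close>, or strictly below \<open>y\<close> and hence below \<open>x2\<close>; so
        no metastable state is met outside the target.\<close>
      fix z assume "\<not> H x2 < H y" "z = y \<or> H z < H y" "z \<notin> insert x0 ?B"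
      with that show "stability_level H \<Delta> z < ?\<Gamma>"
        by (intro less) auto
    qed simp
  qed auto
  have x2: "asymp_one_plus_o (\<lambda>\<beta>. mean_hitting_time (M \<beta> x2) (X \<beta>) (insert x0 ?B))
      (\<lambda>\<beta>. gibbs \<beta> (G \<beta>) x2 / capacity (gibbs \<beta> (G \<beta>)) (P \<beta>) {x2} (insert x0 ?B))"
    using W2.mean_hitting_time_asymptotics[of "\<lambda>\<beta>. M \<beta> x2" X, OF assms(7)] by simp
  have well: "metastable_well \<Delta> P G H (x1 r) {x0} ?B ?\<Gamma>" if r: "r \<in> {1..n}" for r
  proof
    have "x1 r \<noteq> x0"
      using r assms(10) by blast
    show "x1 r \<in> ?B"
      using r by simp
    show "?B \<inter> {x0} = {}"
      using assms(10) by auto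
    show "\<not> (below H \<Delta> (ereal (H (x1 r)) + ?\<Gamma>))\<^sup>*\<^sup>* (x1 r) a" if "a \<in> {x0}" for a
      using that r minimum[OF \<open>x1 r \<noteq> x0\<close>] by (intro separated) auto
    show "(below H \<Delta> (ereal (H (x1 r)) + ?\<Gamma>))\<^sup>*\<^sup>* b (x1 r)" if b: "b \<in> ?B" for b
    proof -
      obtain q where q: "q \<in> {1..n}" "b = x1 q"
        using b by blast
      \<comment> \<open>The assumption measures the climb from \<open>b\<close>; equality of
        energies in the well moves the reference to \<open>x1 r\<close>.\<close>
      have "comm_height H \<Delta> b (x1 r) < ereal (H (x1 r)) + ?\<Gamma>"
        using assms(17)[OF q(1) r] assms(16)[OF q(1) r]
        by (simp add: q(2) ereal_minus_less_iff add.commute)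
      then show ?thesis
        by (rule comm_height_less_imp)
    qed
    show "H (x1 r) < H y \<or> (\<exists>a\<in>{x0}. (below H \<Delta> (ereal (H y) + ?\<Gamma>))\<^sup>*\<^sup>* y a)"
      if "y \<notin> {x0}" "y \<notin> ?B" for y
    proof (unfold disj_imp, intro impI, rule descent_to_set)
      fix z assume y: "\<not> H (x1 r) < H y" and z: "z = y \<or> H z < H y" "z \<notin> {x0}"
      have "z \<noteq> x2"
        using y z(1) assms(15)[OF r] by auto
      \<comment> \<open>A \<open>z\<close> in the well has energy \<open>H (x1 r)\<close>, at least
        that of \<open>y\<close>, so it could only be \<open>y\<close>, which is outside.\<close>
      moreover have "z \<notin> ?B"
        using y z(1) that(2) assms(16)[OF _ r] by fastforce
      ultimately show "stability_level H \<Delta> z < ?\<Gamma>"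
        using z(2) by (intro less) auto
    qed simp
  qed auto
  have
    "asymp_one_plus_o (\<lambda>\<beta>. mean_hitting_time (M \<beta> (x1 r)) (X \<beta>) {x0})
      (\<lambda>\<beta>. (\<Sum>y\<in>?B. gibbs \<beta> (G \<beta>) y) / capacity (gibbs \<beta> (G \<beta>)) (P \<beta>) ?B {x0})"
    "gibbs_degenerate G ?B \<Longrightarrow> asymp_one_plus_o (\<lambda>\<beta>. mean_hitting_time (M \<beta> (x1 r)) (X \<beta>) {x0})
      (\<lambda>\<beta>. real n * gibbs \<beta> (G \<beta>) (x1 r) / capacity (gibbs \<beta> (G \<beta>)) (P \<beta>) {x1 r} {x0})"
    if "r \<in> {1..n}" for r
  proof -
    interpret W1: metastable_well \<Delta> P G H "x1 r" "{x0}" ?B ?\<Gamma>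
      by (rule well[OF that])
    show "asymp_one_plus_o (\<lambda>\<beta>. mean_hitting_time (M \<beta> (x1 r)) (X \<beta>) {x0})
        (\<lambda>\<beta>. (\<Sum>y\<in>?B. gibbs \<beta> (G \<beta>) y) / capacity (gibbs \<beta> (G \<beta>)) (P \<beta>) ?B {x0})"
      by (rule W1.mean_hitting_time_asymptotics) (rule assms(7))
    have "card ?B = n"
      using assms(9) by (simp add: card_image)
    then show "asymp_one_plus_o (\<lambda>\<beta>. mean_hitting_time (M \<beta> (x1 r)) (X \<beta>) {x0})
        (\<lambda>\<beta>. real n * gibbs \<beta> (G \<beta>) (x1 r) / capacity (gibbs \<beta> (G \<beta>)) (P \<beta>) {x1 r} {x0})"
      if "gibbs_degenerate G ?B"
      using W1.mean_hitting_time_asymptotics_degenerate[of "\<lambda>\<beta>. M \<beta> (x1 r)" X, OF assms(7) that]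
      by simp
  qed
  with x2 show ?thesis
    by blast
qed

end
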